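(* Let $(F,v)$ be a valued field, let $E/F$ be a finite field extension, and let $w$ be an exponential quasi-valuation on $E$ extending $v$ whose value monoid $M_w$ is weakly cancellative. Then there are finitely many valuations $u_1,\dots,u_k$ on $E$ extending $v$ such that $w=\min\{u_1,\dots,u_k\}$.
   Context: A totally ordered abelian monoid is a commutative monoid $(M,+)$ with a total order such that $a\le b$ implies $a+c\le b+c$. One adjoins $\infty$, greater than all elements of $M$, with $m+\infty=\infty$. A quasi-valuation on a ring $A$ is a function $w:A\to M\cup\{\infty\}$, $M$ a totally ordered abelian monoid, with $w(0)=\infty$, $w(xy)\ge w(x)+w(y)$ and $w(x+y)\ge\min\{w(x),w(y)\}$ for all $x,y\in A$. $w$ extends $v$ means that the value group $\Gamma_v$ of $v$ is contained in $M$ as an ordered submonoid and $w|_F=v$. $M_w$ is the submonoid of $M$ generated by $w(E\setminus\{0\})$ (for $x\neq 0$ one has $w(x)\neq\infty$). A monoid is weakly cancellative if $a+b=a$ implies $b=0$. $w$ is exponential if $w(x^m)=m\,w(x)$ for all $x\in E$ and $m\in\mathbb N$. Convention: if $w$ is exponential with $M_w$ weakly cancellative then $M_w$ is a group that is torsion over $\Gamma_v$; likewise the value group of every valuation of $E$ extending $v$ is torsion over $\Gamma_v$. All of these are regarded as subgroups of the divisible hull $\Gamma_{\text{div}}$ of $\Gamma_v$ (via the unique order embedding over $\Gamma_v$), and the equality and the minimum are taken in $\Gamma_{\text{div}}\cup\{\infty\}$. *)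

theory Defs
  imports Complex_Main
begin

section \<open>Adjoining infinity to a totally ordered abelian monoid\<close>

text \<open>
  Totally ordered abelian monoids are types of sort
  \<open>{linorder, ordered_comm_monoid_add}\<close>; totally ordered abelian groups are types of class
  \<open>linordered_ab_group_add\<close>.
\<close>

datatype 'm with_infinity = Fin 'm | Infinity

instantiation with_infinity :: (linorder) linorder
begin

fun less_eq_with_infinity :: "'a with_infinity \<Rightarrow> 'a with_infinity \<Rightarrow> bool" where
  "Fin a \<le> Fin b \<longleftrightarrow> a \<le> b"
| "Infinity \<le> Fin b \<longleftrightarrow> False"
| "x \<le> Infinity \<longleftrightarrow> True"

definition less_with_infinity :: "'a with_infinity \<Rightarrow> 'a with_infinity \<Rightarrow> bool" where
  "x < y \<longleftrightarrow> x \<le> y \<and> \<not> y \<le> (x :: 'a with_infinity)"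

instance
proof
  fix x y z :: "'a with_infinity"
  show "x < y \<longleftrightarrow> x \<le> y \<and> \<not> y \<le> x" by (simp add: less_with_infinity_def)
  show "x \<le> x" by (cases x) auto
  show "x \<le> y \<Longrightarrow> y \<le> z \<Longrightarrow> x \<le> z" by (cases x; cases y; cases z) auto
  show "x \<le> y \<Longrightarrow> y \<le> x \<Longrightarrow> x = y" by (cases x; cases y) auto
  show "x \<le> y \<or> y \<le> x" by (cases x; cases y) auto
qed

end

instantiation with_infinity :: (comm_monoid_add) comm_monoid_add
begin

definition zero_with_infinity :: "'a with_infinity" where
  "0 = Fin 0"

fun plus_with_infinity :: "'a with_infinity \<Rightarrow> 'a with_infinity \<Rightarrow> 'a with_infinity" where
  "Fin a + Fin b = Fin (a + b)"
| "Infinity + y = Infinity"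
| "x + Infinity = Infinity"

instance
proof
  fix x y z :: "'a with_infinity"
  show "x + y + z = x + (y + z)" by (cases x; cases y; cases z) (auto simp: add.assoc)
  show "x + y = y + x" by (cases x; cases y) (auto simp: add.commute)
  show "0 + x = x" by (cases x) (auto simp: zero_with_infinity_def)
qed

end

instance with_infinity :: ("{linorder, ordered_comm_monoid_add}") ordered_comm_monoid_add
proof
  fix x y z :: "'a with_infinity"
  show "x \<le> y \<Longrightarrow> z + x \<le> z + y"
    by (cases x; cases y; cases z) (auto intro: add_left_mono)
qed

section \<open>Ordered monoids\<close>

definition nat_mult :: "nat \<Rightarrow> 'm::comm_monoid_add \<Rightarrow> 'm" where
  "nat_mult n a = (\<Sum>i<n. a)"

definition submonoid :: "'m::comm_monoid_add set \<Rightarrow> bool" where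
  "submonoid T \<longleftrightarrow> 0 \<in> T \<and> (\<forall>a\<in>T. \<forall>b\<in>T. a + b \<in> T)"

definition weakly_cancellative :: "'m::comm_monoid_add set \<Rightarrow> bool" where
  "weakly_cancellative T \<longleftrightarrow> (\<forall>a\<in>T. \<forall>b\<in>T. a + b = a \<longrightarrow> b = 0)"

text \<open>
  For a submonoid \<open>S\<close>, the map \<open>f\<close> identifies \<open>S\<close> with an ordered submonoid of the target; its
  values outside \<open>S\<close> are irrelevant.
\<close>

definition ordered_monoid_embedding ::
  "'a::{linorder, ordered_comm_monoid_add} set \<Rightarrow>
    ('a \<Rightarrow> 'b::{linorder, ordered_comm_monoid_add}) \<Rightarrow> bool" where
  "ordered_monoid_embedding S f \<longleftrightarrow>
     f 0 = 0 \<and> (\<forall>a\<in>S. \<forall>b\<in>S. f (a + b) = f a + f b) \<and> strict_mono_on S f"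

text \<open>
  The type \<open>'d\<close>, together with \<open>j\<close> on the group \<open>\<Gamma>\<close>, is a divisible hull of \<open>\<Gamma>\<close>: it is divisible
  and torsion over the image of \<open>\<Gamma>\<close>. (Being totally ordered, \<open>'d\<close> is torsion-free.)
\<close>

definition divisible_hull ::
  "'g::linordered_ab_group_add set \<Rightarrow> ('g \<Rightarrow> 'd::linordered_ab_group_add) \<Rightarrow> bool" where
  "divisible_hull \<Gamma> j \<longleftrightarrow>
     ordered_monoid_embedding \<Gamma> j \<and>
     (\<forall>d::'d. \<forall>n>0. \<exists>d'. nat_mult n d' = d) \<and>
     (\<forall>d::'d. \<exists>n>0. nat_mult n d \<in> j ` \<Gamma>)"

section \<open>Valuations and quasi-valuations\<close>

definition valuation :: "('k::field \<Rightarrow> 'g::linordered_ab_group_add with_infinity) \<Rightarrow> bool" where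
  "valuation v \<longleftrightarrow>
     (\<forall>x. v x = Infinity \<longleftrightarrow> x = 0) \<and>
     (\<forall>x y. v (x * y) = v x + v y) \<and>
     (\<forall>x y. v (x + y) \<ge> min (v x) (v y))"

definition quasi_valuation ::
  "('r::ring \<Rightarrow> 'm::{linorder, ordered_comm_monoid_add} with_infinity) \<Rightarrow> bool" where
  "quasi_valuation w \<longleftrightarrow>
     w 0 = Infinity \<and>
     (\<forall>x y. w (x * y) \<ge> w x + w y) \<and>
     (\<forall>x y. w (x + y) \<ge> min (w x) (w y))"

definition exponential ::
  "('r::ring_1 \<Rightarrow> 'm::{linorder, ordered_comm_monoid_add} with_infinity) \<Rightarrow> bool" where
  "exponential w \<longleftrightarrow> (\<forall>x m. w (x ^ m) = nat_mult m (w x))"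

text \<open>For a valuation \<open>v\<close> of a field, \<open>value_set v\<close> is its value group.\<close>

definition value_set :: "('k::zero \<Rightarrow> 'm with_infinity) \<Rightarrow> 'm set" where
  "value_set w = {m. \<exists>x. x \<noteq> 0 \<and> w x = Fin m}"

definition value_monoid :: "('k::zero \<Rightarrow> 'm::comm_monoid_add with_infinity) \<Rightarrow> 'm set" where
  "value_monoid w = submonoid hull value_set w"

section \<open>Field extensions and extensions of valuations\<close>

text \<open>The extension \<open>E/F\<close> is given by a field embedding \<open>\<iota>\<close> of \<open>F\<close> into \<open>E\<close>.\<close>

definition finite_field_extension :: "('f::field \<Rightarrow> 'e::field) \<Rightarrow> bool" where
  "finite_field_extension \<iota> \<longleftrightarrow>
     \<iota> 1 = 1 \<and>
     (\<forall>a b. \<iota> (a + b) = \<iota> a + \<iota> b) \<and>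
     (\<forall>a b. \<iota> (a * b) = \<iota> a * \<iota> b) \<and>
     (\<exists>B. finite_dimensional_vector_space (\<lambda>a x. \<iota> a * x) B)"

text \<open>
  The map \<open>w\<close> on \<open>E\<close> extends the valuation \<open>v\<close> of \<open>F\<close>, where the value group of \<open>v\<close> is regarded as
  an ordered submonoid of the monoid of values of \<open>w\<close> by means of \<open>\<phi>\<close>.
\<close>

definition extends_valuation ::
  "('f::field \<Rightarrow> 'e::field) \<Rightarrow>
    ('g::linordered_ab_group_add \<Rightarrow> 'm::{linorder, ordered_comm_monoid_add}) \<Rightarrow>
    ('f \<Rightarrow> 'g with_infinity) \<Rightarrow> ('e \<Rightarrow> 'm with_infinity) \<Rightarrow> bool" where
  "extends_valuation \<iota> \<phi> v w \<longleftrightarrow>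
     ordered_monoid_embedding (value_set v) \<phi> \<and>
     (\<forall>a. w (\<iota> a) = map_with_infinity \<phi> (v a))"

text \<open>
  An order embedding of the value monoid of \<open>w\<close> into the divisible hull \<open>'d\<close> of the value group
  of \<open>v\<close> that fixes this value group pointwise, which sits in the two sides via \<open>\<phi>\<close> and \<open>j\<close>.
  By \<open>embedding_over_unique\<close> below there is at most one.
\<close>

definition embedding_over ::
  "('g::linordered_ab_group_add \<Rightarrow> 'm::{linorder, ordered_comm_monoid_add}) \<Rightarrow>
    ('g \<Rightarrow> 'd::linordered_ab_group_add) \<Rightarrow>
    ('f::field \<Rightarrow> 'g with_infinity) \<Rightarrow> ('e::field \<Rightarrow> 'm with_infinity) \<Rightarrow>
    ('m \<Rightarrow> 'd) \<Rightarrow> bool" where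
  "embedding_over \<phi> j v w e \<longleftrightarrow>
     ordered_monoid_embedding (value_monoid w) e \<and> (\<forall>\<gamma>\<in>value_set v. e (\<phi> \<gamma>) = j \<gamma>)"

lemma submonoid_value_monoid: "submonoid (value_monoid w)"
  unfolding value_monoid_def hull_def submonoid_def by blast

lemma nat_mult_0 [simp]: "nat_mult 0 a = 0"
  and nat_mult_Suc: "nat_mult (Suc n) a = a + nat_mult n a"
  by (simp_all add: nat_mult_def add.commute)

lemma nat_mult_inj:
  fixes a b :: "'d::linordered_ab_group_add"
  assumes "n > 0" "nat_mult n a = nat_mult n b"
  shows "a = b"
proof -
  have *: "nat_mult (Suc k) x < nat_mult (Suc k) y" if "x < y" for k and x y :: 'd
    using that by (induction k) (auto simp: nat_mult_Suc intro: add_strict_mono)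
  obtain k where k: "n = Suc k" using assms(1) by (cases n) auto
  show ?thesis using *[of a b k] *[of b a k] assms(2) k by (cases a b rule: linorder_cases) auto
qed

lemma embedding_nat_mult:
  assumes "ordered_monoid_embedding S f" "submonoid S" "m \<in> S"
  shows "nat_mult n m \<in> S \<and> f (nat_mult n m) = nat_mult n (f m)"
  using assms by (induction n) (auto simp: nat_mult_Suc ordered_monoid_embedding_def submonoid_def)

lemma extends_value_set:
  assumes "finite_field_extension \<iota>" "extends_valuation \<iota> \<phi> v w" "\<gamma> \<in> value_set v"
  shows "\<phi> \<gamma> \<in> value_monoid w"
proof -
  obtain a where a: "a \<noteq> 0" "v a = Fin \<gamma>" using assms(3) by (auto simp: value_set_def)
  have "\<iota> a * \<iota> (inverse a) = 1"
    using a(1) assms(1) unfolding finite_field_extension_def by (metis right_inverse)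
  hence "\<iota> a \<noteq> 0" by auto
  hence "\<phi> \<gamma> \<in> value_set w"
    using a assms(2) by (auto simp: value_set_def extends_valuation_def)
  thus ?thesis unfolding value_monoid_def by (rule hull_inc)
qed

lemma embedding_over_unique:
  assumes "finite_field_extension \<iota>" "extends_valuation \<iota> \<phi> v w"
    and "divisible_hull (value_set v) j"
    and e: "embedding_over \<phi> j v w e" and e': "embedding_over \<phi> j v w e'"
    and m: "m \<in> value_monoid w"
  shows "e m = e' m"
proof -
  note S = submonoid_value_monoid[of w]
  obtain n \<gamma> where n: "n > 0" "\<gamma> \<in> value_set v" "nat_mult n (e m) = j \<gamma>"
    using assms(3) unfolding divisible_hull_def by (metis imageE)
  have em: "ordered_monoid_embedding (value_monoid w) e" "ordered_monoid_embedding (value_monoid w) e'"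
    using e e' by (auto simp: embedding_over_def)
  have "e (nat_mult n m) = e (\<phi> \<gamma>)"
    using embedding_nat_mult[OF em(1) S m, of n] n e by (simp add: embedding_over_def)
  moreover have "inj_on e (value_monoid w)"
    using em(1) unfolding ordered_monoid_embedding_def by (auto intro: strict_mono_on_imp_inj_on)
  ultimately have "nat_mult n m = \<phi> \<gamma>"
    using embedding_nat_mult[OF em(1) S m, of n] extends_value_set[OF assms(1,2) n(2)]
    by (auto dest: inj_onD)
  hence "nat_mult n (e' m) = nat_mult n (e m)"
    using embedding_nat_mult[OF em(2) S m, of n] n e' by (simp add: embedding_over_def)
  thus ?thesis using nat_mult_inj[OF n(1)] by metis
qed

end

theory Submission
  imports Defs
begin

text \<open>
  Among the monomials of an algebraic relation of \<open>x\<close> over \<open>F\<close> two must have equal value; with weak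
  cancellation this makes \<open>M\<^sub>w\<close> torsion over \<open>\<Gamma>\<^sub>v\<close>, so \<open>w\<close> may be assumed to take values in the
  divisible hull. Then \<open>R = {w \<ge> 0}\<close> is integrally closed, because \<open>w\<close> is exponential, and every
  \<open>x \<in> E\<close> satisfies a polynomial over the valuation ring of \<open>v\<close> with a unit coefficient. Hence every
  localization of \<open>R\<close> at a prime \<open>P \<supseteq> {w > 0}\<close> is a valuation ring, whose valuation extends \<open>v\<close> and
  dominates \<open>w\<close>. If \<open>w(y) = 0\<close>, no power of \<open>y\<close> lies in \<open>{w > 0}\<close>, so \<open>P\<close> can be chosen to avoid \<open>y\<close>;
  scaling powers of \<open>x\<close> by elements of \<open>F\<close> then yields an extension \<open>u \<ge> w\<close> of \<open>v\<close> with
  \<open>u(x) = w(x)\<close> for any given \<open>x \<noteq> 0\<close>. Finally \<open>v\<close> has at most \<open>[E : F]\<close> extensions, since they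
  admit a system of approximating elements that is linearly independent over \<open>F\<close>.
\<close>

section \<open>Natural multiples in ordered monoids and arithmetic with infinity\<close>

lemma nat_mult_add: "nat_mult (m + n) a = nat_mult m a + nat_mult n a"
  by (induction m) (auto simp: nat_mult_Suc add.assoc)

lemma nat_mult_mult: "nat_mult (m * n) a = nat_mult m (nat_mult n a)"
  by (induction m) (auto simp: nat_mult_Suc nat_mult_add)

lemma nat_mult_swap: "nat_mult m (nat_mult n a) = nat_mult n (nat_mult m a)"
  by (metis nat_mult_mult mult.commute)

lemma nat_mult_distrib: "nat_mult n (a + b) = nat_mult n a + nat_mult n b"
  by (simp add: nat_mult_def sum.distrib)

lemma nat_mult_zero [simp]: "nat_mult n 0 = 0"
  by (simp add: nat_mult_def)

lemma nat_mult_1 [simp]: "nat_mult (Suc 0) a = a"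
  by (simp add: nat_mult_def)

lemma nat_mult_uminus: "nat_mult n (- a) = - nat_mult n (a :: 'd::ab_group_add)"
  by (simp add: nat_mult_def sum_negf)

lemma nat_mult_mono:
  fixes a b :: "'m::{linorder, ordered_comm_monoid_add}"
  shows "a \<le> b \<Longrightarrow> nat_mult n a \<le> nat_mult n b"
  by (simp add: nat_mult_def sum_mono)

lemma nat_mult_le_iff:
  fixes a b :: "'d::linordered_ab_group_add"
  assumes "n > 0"
  shows "nat_mult n a \<le> nat_mult n b \<longleftrightarrow> a \<le> b"
  using nat_mult_mono[of a b n] nat_mult_mono[of b a n] nat_mult_inj[OF assms, of a b]
  by (metis linear order_antisym)

lemma nat_mult_less_iff:
  fixes a b :: "'d::linordered_ab_group_add"
  assumes "n > 0"
  shows "nat_mult n a < nat_mult n b \<longleftrightarrow> a < b"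
  using nat_mult_le_iff[OF assms, of b a] by auto

lemma nat_mult_Fin [simp]: "nat_mult n (Fin a) = Fin (nat_mult n a)"
  by (induction n) (auto simp: nat_mult_Suc zero_with_infinity_def)

lemma plus_Infinity [simp]: "x + Infinity = Infinity"
  by (cases x) auto

lemma nat_mult_Infinity [simp]: "n > 0 \<Longrightarrow> nat_mult n Infinity = Infinity"
  by (cases n) (auto simp: nat_mult_Suc)

lemma le_Infinity [simp]: "x \<le> Infinity"
  by (cases x) auto

lemma Infinity_le_iff [simp]: "Infinity \<le> x \<longleftrightarrow> x = Infinity"
  by (cases x) auto

lemma Fin_less_iff [simp]: "Fin a < Fin b \<longleftrightarrow> a < (b :: 'a::linorder)"
  by (auto simp: less_with_infinity_def)

lemma less_Infinity_iff [simp]: "x < Infinity \<longleftrightarrow> x \<noteq> Infinity"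
  by (cases x) (auto simp: less_with_infinity_def)

text \<open>
  The relation \<open>le\<close> stands for \<open>w(x) \<le> w(y)\<close> as well as for divisibility in a valuation ring.
\<close>

lemma tied_terms:
  fixes f :: "'i \<Rightarrow> 'e::ab_group_add" and le :: "'e \<Rightarrow> 'e \<Rightarrow> bool"
  assumes total: "\<And>x y. le x y \<or> le y x"
    and trans: "\<And>x y z. le x y \<Longrightarrow> le y z \<Longrightarrow> le x z"
    and add: "\<And>x y. le x y \<Longrightarrow> le x (x + y)"
    and uminus: "\<And>x. le x (- x)"
    and zero: "\<And>x. le 0 x \<Longrightarrow> x = 0"
    and S: "finite S" "S \<noteq> {}" "\<And>i. i \<in> S \<Longrightarrow> f i \<noteq> 0" "(\<Sum>i\<in>S. f i) = 0"
  shows "\<exists>i\<in>S. \<exists>k\<in>S. i \<noteq> k \<and> le (f i) (f k) \<and> le (f k) (f i)"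
proof -
  \<comment> \<open>A term of least value is one of the two tied terms: if every other term were
    strictly larger, so would be their sum, although this sum is \<open>- f i\<close>.\<close>
  have "\<exists>i\<in>S. \<forall>k\<in>S. le (f i) (f k)"
    using S(1,2)
  proof (induction S rule: finite_ne_induct)
    case (singleton x)
    then show ?case using total by blast
  next
    case (insert x F)
    then show ?case using total trans by (metis insert_iff)
  qed
  then obtain i where i: "i \<in> S" "\<And>k. k \<in> S \<Longrightarrow> le (f i) (f k)" by blast
  \<comment> \<open>By totality one of the two summands precedes \<open>f x + ?s\<close>; if this
    sum preceded \<open>f i\<close>, that summand would too. The empty sum is covered because
    \<open>f i\<close> is nonzero.\<close>
  have sum: "\<not> le (\<Sum>k\<in>T. f k) (f i)" if "finite T" "\<And>k. k \<in> T \<Longrightarrow> \<not> le (f k) (f i)" for T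
    using that
  proof (induction T rule: finite_induct)
    case empty
    then show ?case using zero S(3)[OF i(1)] by auto
  next
    case (insert x F)
    let ?s = "\<Sum>k\<in>F. f k"
    have *: "\<not> le (f x) (f i)" "\<not> le ?s (f i)" using insert by auto
    have "le (f x) (f x + ?s) \<or> le ?s (f x + ?s)"
      using total[of "f x" ?s] add[of "f x" ?s] add[of ?s "f x"] by (auto simp: add.commute)
    hence "\<not> le (f x + ?s) (f i)"
      using * trans[of "f x" "f x + ?s" "f i"] trans[of ?s "f x + ?s" "f i"] by blast
    thus ?case using insert.hyps by simp
  qed
  have "f i = - (\<Sum>k\<in>S - {i}. f k)"
    using S(4) sum.remove[OF S(1) i(1), of f] by (simp add: eq_neg_iff_add_eq_0)
  hence "le (\<Sum>k\<in>S - {i}. f k) (f i)" using uminus by metis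
  then obtain k where "k \<in> S - {i}" "le (f k) (f i)"
    using sum[of "S - {i}"] S(1) by auto
  thus ?thesis using i by blast
qed

section \<open>Integrally closed subrings\<close>

definition subring :: "'e::ring_1 set \<Rightarrow> bool" where
  "subring R \<longleftrightarrow> 1 \<in> R \<and> (\<forall>x\<in>R. \<forall>y\<in>R. x - y \<in> R \<and> x * y \<in> R)"

definition additive_subgroup :: "'e::ab_group_add set \<Rightarrow> bool" where
  "additive_subgroup P \<longleftrightarrow> 0 \<in> P \<and> (\<forall>x\<in>P. \<forall>y\<in>P. x - y \<in> P)"

definition integrally_closed :: "'e::comm_ring_1 set \<Rightarrow> bool" where
  "integrally_closed R \<longleftrightarrow>
     (\<forall>x n c. n > 0 \<and> (\<forall>i<n. c i \<in> R) \<and> x ^ n = (\<Sum>i<n. c i * x ^ i) \<longrightarrow> x \<in> R)"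

lemma additive_subgroup_add:
  assumes "additive_subgroup P" "x \<in> P" "y \<in> P"
  shows "x + y \<in> P"
proof -
  have "0 - y \<in> P" using assms by (auto simp: additive_subgroup_def simp del: diff_0)
  hence "x - (0 - y) \<in> P" using assms unfolding additive_subgroup_def by blast
  thus ?thesis by simp
qed

lemma subring_imp_additive_subgroup:
  assumes "subring R"
  shows "additive_subgroup R"
  using assms unfolding subring_def additive_subgroup_def by (metis diff_self)

lemma subring_closed:
  assumes "subring R"
  shows "1 \<in> R" "0 \<in> R" "x \<in> R \<Longrightarrow> y \<in> R \<Longrightarrow> x + y \<in> R" "x \<in> R \<Longrightarrow> y \<in> R \<Longrightarrow> x * y \<in> R"
    "x \<in> R \<Longrightarrow> y \<in> R \<Longrightarrow> x - y \<in> R" "x \<in> R \<Longrightarrow> - x \<in> R" "x \<in> R \<Longrightarrow> x ^ n \<in> R"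
proof -
  note s = subring_imp_additive_subgroup[OF assms]
  show "1 \<in> R" "x \<in> R \<Longrightarrow> y \<in> R \<Longrightarrow> x * y \<in> R" "x \<in> R \<Longrightarrow> y \<in> R \<Longrightarrow> x - y \<in> R" for x y
    using assms by (auto simp: subring_def)
  show 0: "0 \<in> R" using s by (auto simp: additive_subgroup_def)
  show "x \<in> R \<Longrightarrow> y \<in> R \<Longrightarrow> x + y \<in> R" using additive_subgroup_add[OF s] .
  show "x \<in> R \<Longrightarrow> - x \<in> R" using 0 assms by (metis diff_0 subring_def)
  show "x \<in> R \<Longrightarrow> x ^ n \<in> R" using assms by (induction n) (auto simp: subring_def)
qed

text \<open>Multiplying the relation by \<open>a (Suc n) ^ n\<close> turns it into a monic equation
  for \<open>a (Suc n) * x\<close> whose coefficients remain in \<open>R\<close>.\<close>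

lemma lead_coeff_times_integral:
  fixes x :: "'e::comm_ring_1"
  assumes R: "subring R" "integrally_closed R"
    and a: "\<And>i. i \<le> Suc n \<Longrightarrow> a i \<in> R" "(\<Sum>i\<le>Suc n. a i * x ^ i) = 0"
  shows "a (Suc n) * x \<in> R"
proof -
  define b where "b = a (Suc n)"
  define c where "c i = - (a i * b ^ (n - i))" for i
  have "(b * x) ^ Suc n = b ^ n * (b * x ^ Suc n)"
    by (simp add: power_mult_distrib algebra_simps)
  also have "b * x ^ Suc n = - (\<Sum>i\<le>n. a i * x ^ i)"
    using a(2) by (simp add: b_def eq_neg_iff_add_eq_0 add.commute)
  also have "b ^ n * - (\<Sum>i\<le>n. a i * x ^ i) = (\<Sum>i\<le>n. c i * (b * x) ^ i)"
    unfolding mult_minus_right sum_distrib_left sum_negf[symmetric]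
  proof (rule sum.cong[OF refl])
    fix i assume "i \<in> {..n}"
    hence "b ^ n = b ^ (n - i) * b ^ i" by (simp flip: power_add)
    thus "- (b ^ n * (a i * x ^ i)) = c i * (b * x) ^ i"
      by (simp add: c_def power_mult_distrib algebra_simps)
  qed
  finally have "(b * x) ^ Suc n = (\<Sum>i<Suc n. c i * (b * x) ^ i)"
    by (simp only: lessThan_Suc_atMost)
  moreover have "c i \<in> R" if "i < Suc n" for i
    unfolding c_def b_def using that a(1) by (intro subring_closed[OF R(1)]) auto
  ultimately show ?thesis using R(2) unfolding integrally_closed_def b_def by blast
qed

text \<open>
  Induction on the degree: if the leading coefficient \<open>a\<close> and \<open>a x\<close> both lie in \<open>P\<close>, then \<open>a x\<close>, which
  lies in \<open>R\<close>, can be absorbed into the next coefficient.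
\<close>

lemma integral_fraction:
  fixes x :: "'e::comm_ring_1"
  assumes R: "subring R" "integrally_closed R" and P: "additive_subgroup P"
  shows "(\<And>i. i \<le> n \<Longrightarrow> a i \<in> R) \<Longrightarrow> (\<Sum>i\<le>n. a i * x ^ i) = 0 \<Longrightarrow> \<exists>i\<le>n. a i \<notin> P \<Longrightarrow>
    \<exists>s\<in>R. s * x \<in> R \<and> (s \<notin> P \<or> s * x \<notin> P)"
proof (induction n arbitrary: a)
  case 0
  then show ?case using P by (auto simp: additive_subgroup_def)
next
  case (Suc n)
  have ax: "a (Suc n) * x \<in> R" using lead_coeff_times_integral[OF R] Suc.prems by blast
  show ?case
  proof (cases "a (Suc n) \<in> P \<and> a (Suc n) * x \<in> P")
    case False
    then show ?thesis using ax Suc.prems(1) by blast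
  next
    case True
    define b where "b i = (if i = n then a n + a (Suc n) * x else a i)" for i
    have "b i \<in> R" if "i \<le> n" for i
      using that Suc.prems(1) ax by (auto simp: b_def intro: subring_closed[OF R(1)])
    moreover have "(\<Sum>i\<le>n. b i * x ^ i) = 0"
    proof -
      have "(\<Sum>i\<le>n. b i * x ^ i) = (\<Sum>i<n. b i * x ^ i) + b n * x ^ n"
        by (simp add: lessThan_Suc_atMost[symmetric])
      also have "(\<Sum>i<n. b i * x ^ i) = (\<Sum>i<n. a i * x ^ i)"
        by (rule sum.cong) (auto simp: b_def)
      also have "\<dots> + b n * x ^ n = (\<Sum>i\<le>Suc n. a i * x ^ i)"
        by (simp add: lessThan_Suc_atMost[symmetric] b_def algebra_simps)
      finally show ?thesis using Suc.prems(2) by simp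
    qed
    \<comment> \<open>A coefficient outside \<open>P\<close> survives: it is not the leading one,
      and at index \<open>n\<close> the change is by an element of \<open>P\<close>.\<close>
    moreover have "\<exists>i\<le>n. b i \<notin> P"
    proof -
      obtain i where i: "i \<le> Suc n" "a i \<notin> P" using Suc.prems(3) by blast
      hence "i \<le> n" using True by (metis le_Suc_eq)
      moreover have "a n \<in> P" if "b n \<in> P"
      proof -
        have "b n - a (Suc n) * x \<in> P" using that True P by (auto simp: additive_subgroup_def)
        thus ?thesis by (simp add: b_def)
      qed
      ultimately show ?thesis using i(2) by (metis b_def)
    qed
    ultimately show ?thesis using Suc.IH by blast
  qed
qed

section \<open>Prime ideals and localization\<close>

definition ideal :: "'e::comm_ring_1 set \<Rightarrow> 'e set \<Rightarrow> bool" where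
  "ideal R J \<longleftrightarrow> J \<subseteq> R \<and> additive_subgroup J \<and> (\<forall>r\<in>R. \<forall>p\<in>J. r * p \<in> J)"

definition prime_ideal :: "'e::comm_ring_1 set \<Rightarrow> 'e set \<Rightarrow> bool" where
  "prime_ideal R P \<longleftrightarrow>
     ideal R P \<and> 1 \<notin> P \<and> (\<forall>x\<in>R. \<forall>y\<in>R. x * y \<in> P \<longrightarrow> x \<in> P \<or> y \<in> P)"

text \<open>The ideal generated by \<open>J\<close> and \<open>a\<close>; it is the enlargement
  against which maximality is tested in the prime ideal argument.\<close>

lemma ideal_add_principal:
  assumes R: "subring R" and J: "ideal R J" and a: "a \<in> R"
  shows "ideal R {p + r * a | p r. p \<in> J \<and> r \<in> R}" (is "ideal R ?K")
    and "J \<subseteq> {p + r * a | p r. p \<in> J \<and> r \<in> R}"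
    and "a \<in> {p + r * a | p r. p \<in> J \<and> r \<in> R}"
proof -
  note R' = subring_closed[OF R]
  have J': "J \<subseteq> R" "0 \<in> J" "\<And>x y. x \<in> J \<Longrightarrow> y \<in> J \<Longrightarrow> x - y \<in> J"
      "\<And>r p. r \<in> R \<Longrightarrow> p \<in> J \<Longrightarrow> r * p \<in> J"
    using J by (auto simp: ideal_def additive_subgroup_def)
  show sub: "J \<subseteq> ?K"
  proof
    fix p assume "p \<in> J"
    moreover have "p = p + 0 * a" by simp
    ultimately show "p \<in> ?K" using R'(2) by blast
  qed
  show "a \<in> ?K"
  proof -
    have "a = 0 + 1 * a" by simp
    thus ?thesis using J'(2) R'(1) by blast
  qed
  have "?K \<subseteq> R" using J'(1) R'(3,4) a by auto
  moreover have "additive_subgroup ?K"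
    unfolding additive_subgroup_def
  proof (intro conjI ballI)
    show "0 \<in> ?K" using sub J'(2) by (rule subsetD)
    fix x y assume "x \<in> ?K" "y \<in> ?K"
    then obtain p r q s where *: "x = p + r * a" "y = q + s * a" "p \<in> J" "q \<in> J" "r \<in> R" "s \<in> R"
      by blast
    have "x - y = (p - q) + (r - s) * a" using * by (simp add: algebra_simps)
    thus "x - y \<in> ?K" using * J'(3) R'(5) by blast
  qed
  moreover have "r * x \<in> ?K" if "r \<in> R" "x \<in> ?K" for r x
  proof -
    obtain p s where *: "x = p + s * a" "p \<in> J" "s \<in> R" using \<open>x \<in> ?K\<close> by blast
    have "r * x = r * p + (r * s) * a" using * by (simp add: algebra_simps)
    thus ?thesis using * J'(4) R'(4) that(1) by blast
  qed
  ultimately show "ideal R ?K" by (auto simp: ideal_def)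
qed

text \<open>By Zorn's lemma there is an ideal maximal among those that contain \<open>I\<close> and
  no power of \<open>y\<close>; such an ideal is prime.\<close>

lemma prime_ideal_avoiding_powers:
  assumes R: "subring R" and I: "ideal R I" and y: "y \<in> R" "\<And>n. y ^ n \<notin> I"
  shows "\<exists>P. prime_ideal R P \<and> I \<subseteq> P \<and> y \<notin> P"
proof -
  define A where "A = {J. ideal R J \<and> I \<subseteq> J \<and> (\<forall>n. y ^ n \<notin> J)}"
  have "\<exists>M\<in>A. \<forall>X\<in>A. M \<subseteq> X \<longrightarrow> X = M"
  proof (rule subset_Zorn_nonempty)
    show "A \<noteq> {}" using I y by (auto simp: A_def)
    fix C assume C: "C \<noteq> {}" "subset.chain A C"
    have CA: "C \<subseteq> A" and chain: "\<And>X Y. X \<in> C \<Longrightarrow> Y \<in> C \<Longrightarrow> X \<subseteq> Y \<or> Y \<subseteq> X"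
      using C(2) unfolding subset_chain_def by auto
    have ideals: "ideal R X" if "X \<in> C" for X using that CA by (auto simp: A_def)
    have "additive_subgroup (\<Union>C)"
      unfolding additive_subgroup_def
    proof (intro conjI ballI)
      show "0 \<in> \<Union>C" using C(1) ideals by (auto simp: ideal_def additive_subgroup_def)
      fix x z assume "x \<in> \<Union>C" "z \<in> \<Union>C"
      then obtain X where "X \<in> C" "x \<in> X" "z \<in> X" using chain by blast
      thus "x - z \<in> \<Union>C" using ideals[of X] by (auto simp: ideal_def additive_subgroup_def)
    qed
    moreover have "\<Union>C \<subseteq> R" "\<forall>r\<in>R. \<forall>p\<in>\<Union>C. r * p \<in> \<Union>C"
      using ideals unfolding ideal_def by blast+
    moreover have "I \<subseteq> \<Union>C" "\<forall>n. y ^ n \<notin> \<Union>C" using C(1) CA by (auto simp: A_def)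
    ultimately show "\<Union>C \<in> A" by (simp add: A_def ideal_def)
  qed
  then obtain P where "P \<in> A" and max: "\<And>X. X \<in> A \<Longrightarrow> P \<subseteq> X \<Longrightarrow> X = P" by blast
  hence P: "ideal R P" "I \<subseteq> P" "\<And>n. y ^ n \<notin> P" by (auto simp: A_def)
  have P': "additive_subgroup P" "\<And>r p. r \<in> R \<Longrightarrow> p \<in> P \<Longrightarrow> r * p \<in> P"
    using P(1) by (auto simp: ideal_def)
  \<comment> \<open>Adjoining \<open>a\<close> to \<open>P\<close> enlarges it, so maximality puts a
    power of \<open>y\<close> into the larger ideal.\<close>
  have power: "\<exists>n. \<exists>p\<in>P. \<exists>r\<in>R. y ^ n = p + r * a" if "a \<in> R" "a \<notin> P" for a
  proof -
    note K = ideal_add_principal[OF R P(1) that(1)]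
    have "{p + r * a | p r. p \<in> P \<and> r \<in> R} \<notin> A" using max[OF _ K(2)] K(3) that(2) by blast
    hence "\<exists>n. y ^ n \<in> {p + r * a | p r. p \<in> P \<and> r \<in> R}" using K(1,2) P(2) by (auto simp: A_def)
    thus ?thesis by blast
  qed
  have "a \<in> P \<or> b \<in> P" if ab: "a \<in> R" "b \<in> R" "a * b \<in> P" for a b
  proof (rule ccontr)
    assume *: "\<not> (a \<in> P \<or> b \<in> P)"
    obtain n p r where 1: "p \<in> P" "r \<in> R" "y ^ n = p + r * a" using power[of a] ab * by blast
    obtain m q s where 2: "q \<in> P" "s \<in> R" "y ^ m = q + s * b" using power[of b] ab * by blast
    \<comment> \<open>The product of the two powers expands into multiples of \<open>p\<close>,
      \<open>q\<close> and \<open>a * b\<close>, all of which lie in \<open>P\<close>.\<close>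
    have "y ^ (n + m) = (q + s * b) * p + ((r * a) * q + (r * s) * (a * b))"
      using 1 2 by (simp add: power_add algebra_simps)
    moreover have "q + s * b \<in> R" "r * a \<in> R" "r * s \<in> R"
      using 1(2) 2(1,2) ab(1,2) P(1) subring_closed(3,4)[OF R] by (auto simp: ideal_def)
    ultimately have "y ^ (n + m) \<in> P"
      using 1(1) 2(1) ab(3) by (auto intro!: additive_subgroup_add[OF P'(1)] P'(2)[OF _ 1(1)]
        P'(2)[OF _ 2(1)] P'(2)[OF _ ab(3)])
    thus False using P(3) by blast
  qed
  \<comment> \<open>Missing \<open>y ^ 0\<close> makes \<open>P\<close> proper, and missing
    \<open>y ^ 1\<close> gives \<open>y \<notin> P\<close>.\<close>
  moreover have "1 \<notin> P" using P(3)[of 0] by simp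
  ultimately have "prime_ideal R P" using P(1) by (auto simp: prime_ideal_def)
  thus ?thesis using P(2) P(3)[of 1] by auto
qed

definition localization :: "'e::field set \<Rightarrow> 'e set \<Rightarrow> 'e set" where
  "localization R P = {r / s | r s. r \<in> R \<and> s \<in> R \<and> s \<notin> P}"

lemma
  fixes R :: "'e::field set"
  assumes R: "subring R" and P: "prime_ideal R P"
  shows subring_localization: "subring (localization R P)"
    and localization_unit: "x \<in> P \<Longrightarrow> x \<noteq> 0 \<Longrightarrow> inverse x \<notin> localization R P"
    and localization_contains: "x \<in> R \<Longrightarrow> x \<in> localization R P"
proof -
  note R' = subring_closed[OF R]
  have P': "0 \<in> P" "1 \<notin> P" "\<And>x y. x \<in> R \<Longrightarrow> y \<in> R \<Longrightarrow> x * y \<in> P \<Longrightarrow> x \<in> P \<or> y \<in> P"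
      "\<And>r p. r \<in> R \<Longrightarrow> p \<in> P \<Longrightarrow> r * p \<in> P"
    using P by (auto simp: prime_ideal_def ideal_def additive_subgroup_def)
  show cont: "x \<in> localization R P" if "x \<in> R" for x
  proof -
    have "x = x / 1" by simp
    thus ?thesis unfolding localization_def using that R'(1) P'(2) by blast
  qed
  show "inverse x \<notin> localization R P" if "x \<in> P" "x \<noteq> 0"
  proof
    assume "inverse x \<in> localization R P"
    then obtain r s where *: "inverse x = r / s" "r \<in> R" "s \<in> R" "s \<notin> P"
      by (auto simp: localization_def)
    hence "s = r * x" using that P'(1) by (auto simp: field_simps)
    thus False using * P'(4) that by blast
  qed
  show "subring (localization R P)"
    unfolding subring_def
  proof (intro conjI ballI)
    show "1 \<in> localization R P" using cont R'(1) by blast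
    fix x y assume "x \<in> localization R P" "y \<in> localization R P"
    then obtain r s r' s' where *: "x = r / s" "y = r' / s'" "r \<in> R" "r' \<in> R" "s \<in> R" "s' \<in> R"
        "s \<notin> P" "s' \<notin> P"
      unfolding localization_def by blast
    have nz: "s \<noteq> 0" "s' \<noteq> 0" using * P'(1) by auto
    have s: "s * s' \<in> R" "s * s' \<notin> P" using * P'(3) R'(4) by blast+
    have "x - y = (r * s' - r' * s) / (s * s')" "x * y = (r * r') / (s * s')"
      using * nz by (auto simp: field_simps)
    moreover have "r * s' - r' * s \<in> R" "r * r' \<in> R" using * R'(4,5) by auto
    ultimately show "x - y \<in> localization R P" "x * y \<in> localization R P"
      using s unfolding localization_def by blast+
  qed
qed

section \<open>Elementary properties of quasi-valuations\<close>

lemma quasi_valuation_sum: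
  assumes w: "quasi_valuation w" and "finite S" "\<And>i. i \<in> S \<Longrightarrow> d \<le> w (f i)"
  shows "d \<le> w (\<Sum>i\<in>S. f i)"
  using assms(2,3)
proof (induction S rule: finite_induct)
  case empty
  then show ?case using w by (simp add: quasi_valuation_def)
next
  case (insert i S)
  have "d \<le> min (w (f i)) (w (\<Sum>i\<in>S. f i))" using insert by simp
  also have "\<dots> \<le> w (f i + (\<Sum>i\<in>S. f i))" using w by (auto simp: quasi_valuation_def)
  finally show ?case using insert by simp
qed

lemma quasi_valuation_sum_less:
  assumes w: "quasi_valuation w" and d: "d \<noteq> Infinity"
    and "finite S" "\<And>i. i \<in> S \<Longrightarrow> d < w (f i)"
  shows "d < w (\<Sum>i\<in>S. f i)"
  using assms(3,4)
proof (induction S rule: finite_induct)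
  case empty
  then show ?case using w d by (simp add: quasi_valuation_def)
next
  case (insert i S)
  have "d < min (w (f i)) (w (\<Sum>i\<in>S. f i))" using insert by simp
  also have "\<dots> \<le> w (f i + (\<Sum>i\<in>S. f i))" using w by (auto simp: quasi_valuation_def)
  finally show ?case using insert by simp
qed

lemma exponential_1:
  assumes "exponential w"
  shows "w 1 = 0"
proof -
  have "w (1 ^ 0) = nat_mult 0 (w 1)" using assms unfolding exponential_def by blast
  thus ?thesis by simp
qed

text \<open>An infinite value of \<open>x\<close> would make \<open>w (x * inverse x)\<close>
  infinite, but \<open>w 1 = 0\<close>.\<close>

lemma quasi_valuation_not_Infinity:
  fixes x :: "'e::field"
  assumes "quasi_valuation w" "exponential w" "x \<noteq> 0"
  shows "w x \<noteq> Infinity"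
proof
  assume "w x = Infinity"
  moreover have "w x + w (inverse x) \<le> w (x * inverse x)" using assms(1) by (simp add: quasi_valuation_def)
  ultimately show False using assms(3) exponential_1[OF assms(2)] by (simp add: zero_with_infinity_def)
qed

text \<open>Since \<open>(- 1) ^ 2 = 1\<close>, the value \<open>d\<close> of \<open>- 1\<close>
  satisfies \<open>d + d = 0\<close>. In a totally ordered monoid this already forces
  \<open>d = 0\<close>: if \<open>d \<le> 0\<close> then \<open>d + d \<le> d\<close>, and
  dually.\<close>

lemma quasi_valuation_uminus:
  fixes x :: "'e::field"
  assumes w: "quasi_valuation w" "exponential w"
  shows "w (- x) = w x"
proof -
  obtain d where d: "w (- 1) = Fin d" using quasi_valuation_not_Infinity[OF w, of "- 1"] by (cases "w (- 1)") auto
  have "nat_mult 2 (w (- 1)) = w ((- 1) ^ 2)" using w(2) unfolding exponential_def by metis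
  hence "d + d = 0" using d exponential_1[OF w(2)]
    by (simp add: zero_with_infinity_def numeral_2_eq_2 nat_mult_Suc)
  hence "d = 0" using add_left_mono[of d 0 d] add_left_mono[of 0 d d] linear[of d 0]
    by (auto intro: order_antisym)
  hence *: "w x' \<le> w (- x')" for x'
  proof -
    have "w (- 1) + w x' \<le> w (- 1 * x')" using w(1) unfolding quasi_valuation_def by blast
    thus ?thesis using d \<open>d = 0\<close> by (simp flip: zero_with_infinity_def)
  qed
  show ?thesis using *[of x] *[of "- x"] by simp
qed

lemma subring_nonneg:
  fixes w :: "'e::field \<Rightarrow> 'm::{linorder, ordered_comm_monoid_add} with_infinity"
  assumes w: "quasi_valuation w" "exponential w"
  shows "subring {x. 0 \<le> w x}"
  unfolding subring_def
proof (intro conjI ballI; clarify)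
  show "0 \<le> w 1" using exponential_1[OF w(2)] by simp
  fix x y assume "0 \<le> w x" "0 \<le> w y"
  moreover from this have "0 \<le> w x + w y" by simp
  moreover have "min (w x) (w (- y)) \<le> w (x + - y)" "w x + w y \<le> w (x * y)"
    using w(1) unfolding quasi_valuation_def by blast+
  ultimately show "0 \<le> w (x - y)" "0 \<le> w (x * y)"
    using quasi_valuation_uminus[OF w, of y]
      order_trans[of 0 "min (w x) (w y)" "w (x - y)"] order_trans[of 0 "w x + w y" "w (x * y)"]
    by simp_all
qed

lemma ideal_pos:
  fixes w :: "'e::field \<Rightarrow> 'm::{linorder, ordered_comm_monoid_add} with_infinity"
  assumes w: "quasi_valuation w" "exponential w"
  shows "ideal {x. 0 \<le> w x} {x. 0 < w x}"
  unfolding ideal_def additive_subgroup_def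
proof (intro conjI ballI; clarify)
  show "0 < w 0" using w(1) by (simp add: quasi_valuation_def zero_with_infinity_def)
  fix x y assume *: "0 < w y"
  have "w x + w y \<le> w (x * y)" using w(1) unfolding quasi_valuation_def by blast
  moreover have "0 + w y \<le> w x + w y" if "0 \<le> w x" using that by (rule add_right_mono)
  ultimately show "0 < w (x * y)" if "0 \<le> w x" using that * by simp
  have "min (w x) (w (- y)) \<le> w (x + - y)"
    using w(1) unfolding quasi_valuation_def by blast
  thus "0 < w (x - y)" if "0 < w x"
    using that * quasi_valuation_uminus[OF w, of y] by (auto simp: min_def split: if_splits)
qed auto

text \<open>If the value \<open>d\<close> of \<open>x\<close> were negative, the right-hand side of
  a monic equation of degree \<open>Suc k\<close> would have value at least
  \<open>nat_mult k d\<close>, while \<open>x ^ Suc k\<close> has the value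
  \<open>nat_mult (Suc k) d\<close>, which is smaller by cancellation in the group.\<close>

lemma integrally_closed_nonneg:
  fixes w :: "'e::field \<Rightarrow> 'd::linordered_ab_group_add with_infinity"
  assumes w: "quasi_valuation w" "exponential w"
  shows "integrally_closed {x. 0 \<le> w x}"
  unfolding integrally_closed_def
proof (intro allI impI, elim conjE, rule CollectI, rule ccontr)
  fix x n c assume n: "n > 0" and c: "\<forall>i<n. c i \<in> {x. 0 \<le> w x}" and x: "x ^ n = (\<Sum>i<n. c i * x ^ i)"
    and neg: "\<not> 0 \<le> w x"
  obtain d where d: "w x = Fin d" "d < 0" using neg by (cases "w x") (auto simp: zero_with_infinity_def)
  obtain k where k: "n = Suc k" using n by (cases n) auto
  have pow: "w (x ^ i) = Fin (nat_mult i d)" for i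
    using w(2) d(1) by (simp add: exponential_def)
  have "Fin (nat_mult k d) \<le> w (c i * x ^ i)" if "i \<in> {..<n}" for i
  proof -
    have "i \<le> k" using that k by simp
    then obtain l where l: "k = i + l" using le_Suc_ex by blast
    have "nat_mult l d \<le> 0" using nat_mult_mono[of d 0 l] d(2) by simp
    hence "Fin (nat_mult k d) \<le> 0 + w (x ^ i)"
      by (simp add: l nat_mult_add pow)
    also have "\<dots> \<le> w (c i) + w (x ^ i)" using c that by (intro add_right_mono) auto
    also have "\<dots> \<le> w (c i * x ^ i)" using w(1) unfolding quasi_valuation_def by blast
    finally show ?thesis .
  qed
  hence "Fin (nat_mult k d) \<le> w (x ^ n)"
    unfolding x by (intro quasi_valuation_sum[OF w(1)]) auto
  hence "nat_mult k d \<le> nat_mult (Suc k) d" unfolding pow k by simp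
  thus False using d(2) by (simp add: nat_mult_Suc)
qed

section \<open>Valuations as exponential quasi-valuations\<close>

lemma valuation_mult: "valuation u \<Longrightarrow> u (x * y) = u x + u y"
  and valuation_add: "valuation u \<Longrightarrow> min (u x) (u y) \<le> u (x + y)"
  and valuation_eq_Infinity: "valuation u \<Longrightarrow> u x = Infinity \<longleftrightarrow> x = 0"
  by (auto simp: valuation_def)

lemma valuation_1:
  assumes "valuation u"
  shows "u 1 = 0"
proof -
  have "u (1 * 1) = u 1 + u 1" "u 1 \<noteq> Infinity" using assms by (simp_all only: valuation_def) simp
  thus ?thesis by (cases "u 1") (auto simp: zero_with_infinity_def)
qed

lemma valuation_power:
  assumes "valuation u"
  shows "u (x ^ n) = nat_mult n (u x)"
  using assms by (induction n) (auto simp: nat_mult_Suc valuation_1 valuation_mult)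

lemma valuation_imp_quasi_valuation: "valuation u \<Longrightarrow> quasi_valuation u"
  by (simp add: valuation_def quasi_valuation_def)

lemma valuation_imp_exponential: "valuation u \<Longrightarrow> exponential u"
  by (simp add: exponential_def valuation_power)

lemma valuation_inverse:
  assumes u: "valuation u" and x: "u x = Fin d"
  shows "u (inverse x) = Fin (- d)"
proof -
  have "x \<noteq> 0" using valuation_eq_Infinity[OF u, of x] x by auto
  hence "u x + u (inverse x) = 0" using valuation_mult[OF u, of x "inverse x"] valuation_1[OF u] by simp
  thus ?thesis using x by (cases "u (inverse x)") (auto simp: zero_with_infinity_def add_eq_0_iff)
qed

lemma valuation_divide:
  assumes "valuation u" "u x = Fin d" "u y = Fin d'"
  shows "u (x / y) = Fin (d - d')"
  using assms by (simp add: divide_inverse valuation_mult valuation_inverse)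

section \<open>Valuations of a finite extension\<close>

locale field_extension =
  fixes \<iota> :: "'f::field \<Rightarrow> 'e::field"
  assumes extension: "finite_field_extension \<iota>"
begin

lemma emb_1 [simp]: "\<iota> 1 = 1"
  and emb_add: "\<iota> (a + b) = \<iota> a + \<iota> b"
  and emb_mult: "\<iota> (a * b) = \<iota> a * \<iota> b"
  using extension by (auto simp: finite_field_extension_def)

lemma emb_0 [simp]: "\<iota> 0 = 0"
  using emb_add[of 0 0] by (metis add_0 add_right_cancel)

lemma emb_eq_0_iff [simp]: "\<iota> a = 0 \<longleftrightarrow> a = 0"
proof
  assume "\<iota> a = 0"
  hence "\<iota> (a * inverse a) = 0" by (simp add: emb_mult)
  thus "a = 0" by (cases "a = 0") auto
qed auto

lemma emb_uminus: "\<iota> (- a) = - \<iota> a"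
  using emb_add[of a "- a"] by (simp add: eq_neg_iff_add_eq_0 add.commute)

lemma emb_inverse: "\<iota> (inverse a) = inverse (\<iota> a)"
proof (cases "a = 0")
  case False
  hence "\<iota> a * \<iota> (inverse a) = 1" by (simp flip: emb_mult)
  thus ?thesis by (metis inverse_unique)
qed auto

lemma emb_divide: "\<iota> (a / b) = \<iota> a / \<iota> b"
  by (simp add: divide_inverse emb_mult emb_inverse)

lemma emb_power: "\<iota> (a ^ n) = \<iota> a ^ n"
  by (induction n) (auto simp: emb_mult)

text \<open>The bound is the size of a basis. Indexed families instead of sets make repeated vectors
  count as dependent; the lemma serves both the powers of one element and the approximating elements
  of many valuations.\<close>

lemma dependent_family:
  "\<exists>N. \<forall>(x :: 'i \<Rightarrow> 'e) I. finite I \<and> N < card I \<longrightarrow>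
     (\<exists>c. (\<exists>i\<in>I. c i \<noteq> 0) \<and> (\<Sum>i\<in>I. \<iota> (c i) * x i) = 0)"
proof -
  obtain B where "finite_dimensional_vector_space (\<lambda>a x. \<iota> a * x) B"
    using extension by (auto simp: finite_field_extension_def)
  then interpret vs: finite_dimensional_vector_space "\<lambda>a x. \<iota> a * x" B .
  have "\<exists>c. (\<exists>i\<in>I. c i \<noteq> 0) \<and> (\<Sum>i\<in>I. \<iota> (c i) * x i) = 0"
    if I: "finite I" "card B < card I" for x :: "'i \<Rightarrow> 'e" and I
  proof (cases "inj_on x I")
    case True
    have "vs.dependent (x ` I)"
      using vs.independent_card_le_dim[of "x ` I" UNIV] I card_image[OF True] by auto
    then obtain c where c: "\<exists>y\<in>x ` I. c y \<noteq> 0" "(\<Sum>y\<in>x ` I. \<iota> (c y) * y) = 0"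
      using vs.dependent_finite[of "x ` I"] I(1) by auto
    have "(\<Sum>i\<in>I. \<iota> (c (x i)) * x i) = 0"
      using c(2) by (simp add: sum.reindex[OF True])
    thus ?thesis using c(1) by (intro exI[of _ "c \<circ> x"]) auto
  next
    case False
    then obtain i k where ik: "i \<in> I" "k \<in> I" "i \<noteq> k" "x i = x k" by (auto simp: inj_on_def)
    define c :: "'i \<Rightarrow> 'f" where "c l = (if l = i then 1 else if l = k then - 1 else 0)" for l
    have "(\<Sum>l\<in>I. \<iota> (c l) * x l) = (\<Sum>l\<in>{i, k}. \<iota> (c l) * x l)"
      using ik I by (intro sum.mono_neutral_right) (auto simp: c_def)
    also have "\<dots> = 0" using ik by (simp add: c_def emb_uminus)
    finally show ?thesis using ik(1) by (intro exI[of _ c]) (auto simp: c_def)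
  qed
  thus ?thesis by blast
qed

lemma algebraic_relation:
  obtains n and c :: "nat \<Rightarrow> 'f" where "\<exists>i\<le>n. c i \<noteq> 0" "(\<Sum>i\<le>n. \<iota> (c i) * x ^ i) = 0"
proof -
  obtain N where "\<exists>c. (\<exists>i\<in>{..N}. c i \<noteq> 0) \<and> (\<Sum>i\<le>N. \<iota> (c i) * x ^ i) = 0"
    using dependent_family[where 'i = nat] by (metis card_atMost finite_atMost lessI)
  thus ?thesis using that by auto
qed

text \<open>A tie relates \<open>x ^ (k - i)\<close> to an element of \<open>F\<close>. This is how
  values of \<open>x\<close> are found to be torsion, once for \<open>w\<close> and once for
  divisibility in a valuation ring.\<close>

lemma tied_monomials:
  fixes le :: "'e \<Rightarrow> 'e \<Rightarrow> bool"
  assumes le: "\<And>x y. le x y \<or> le y x"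
    "\<And>x y z. le x y \<Longrightarrow> le y z \<Longrightarrow> le x z"
    "\<And>x y. le x y \<Longrightarrow> le x (x + y)"
    "\<And>x. le x (- x)"
    "\<And>x. le 0 x \<Longrightarrow> x = 0"
    and x: "x \<noteq> 0"
  obtains i k a b where "i < k" "a \<noteq> 0" "b \<noteq> 0"
    "le (\<iota> a * x ^ i) (\<iota> b * x ^ k)" "le (\<iota> b * x ^ k) (\<iota> a * x ^ i)"
proof -
  obtain n c where c: "\<exists>i\<le>n. c i \<noteq> 0" "(\<Sum>i\<le>n. \<iota> (c i) * x ^ i) = 0"
    using algebraic_relation by blast
  define S where "S = {i. i \<le> n \<and> c i \<noteq> 0}"
  have S: "finite S" "S \<noteq> {}" using c(1) by (auto simp: S_def)
  have "(\<Sum>i\<in>S. \<iota> (c i) * x ^ i) = (\<Sum>i\<le>n. \<iota> (c i) * x ^ i)"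
    by (rule sum.mono_neutral_left) (auto simp: S_def)
  hence "(\<Sum>i\<in>S. \<iota> (c i) * x ^ i) = 0" using c(2) by simp
  hence "\<exists>i\<in>S. \<exists>k\<in>S. i \<noteq> k \<and> le (\<iota> (c i) * x ^ i) (\<iota> (c k) * x ^ k) \<and>
      le (\<iota> (c k) * x ^ k) (\<iota> (c i) * x ^ i)"
    using S x by (intro tied_terms[where f = "\<lambda>i. \<iota> (c i) * x ^ i", OF le]) (auto simp: S_def)
  then obtain i k where ik: "i \<in> S" "k \<in> S" "i \<noteq> k" "le (\<iota> (c i) * x ^ i) (\<iota> (c k) * x ^ k)"
      "le (\<iota> (c k) * x ^ k) (\<iota> (c i) * x ^ i)" by blast
  thus ?thesis
    using that[of i k "c i" "c k"] that[of k i "c k" "c i"] by (cases i k rule: linorder_cases) (auto simp: S_def)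
qed

end

text \<open>
  Here \<open>v\<close> already takes its values in the divisible hull; in the final theorem it is \<open>j \<circ> v\<close>.
\<close>

locale valued_extension = field_extension \<iota>
  for \<iota> :: "'f::field \<Rightarrow> 'e::field" +
  fixes v :: "'f \<Rightarrow> 'd::linordered_ab_group_add with_infinity"
  assumes valuation: "valuation v"
    and divisible: "n > 0 \<Longrightarrow> \<exists>d'. nat_mult n d' = (d :: 'd)"
    and torsion: "\<exists>n>0. \<exists>a. v a = Fin (nat_mult n d)"
begin

section \<open>Valuation rings of \<open>E\<close> over the valuation ring of
  \<open>v\<close>\<close>

lemma normalized_relation:
  obtains n c where "\<And>i. i \<le> n \<Longrightarrow> 0 \<le> v (c i)" "\<exists>i\<le>n. v (c i) = 0"
    "(\<Sum>i\<le>n. \<iota> (c i) * x ^ i) = 0"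
proof -
  obtain n c where c: "\<exists>i\<le>n. c i \<noteq> 0" "(\<Sum>i\<le>n. \<iota> (c i) * x ^ i) = 0"
    using algebraic_relation by blast
  \<comment> \<open>Division by a coefficient of least value makes all coefficients integral and
    this one of value \<open>0\<close>.\<close>
  obtain k where k: "k \<le> n" "\<And>i. i \<le> n \<Longrightarrow> v (c k) \<le> v (c i)"
    using ex_min_if_finite[of "(\<lambda>i. v (c i)) ` {..n}"] by (force simp: not_less)
  have "v (c k) \<noteq> Infinity"
    using k(2) c(1) valuation_eq_Infinity[OF valuation] by (metis Infinity_le_iff)
  then obtain d where d: "v (c k) = Fin d" by (cases "v (c k)") auto
  define c' where "c' i = c i * inverse (c k)" for i
  have v': "v (c' i) = v (c i) + Fin (- d)" for i
    by (simp add: c'_def valuation_mult[OF valuation] valuation_inverse[OF valuation d])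
  have "v (c' k) = 0" by (simp add: v' d zero_with_infinity_def)
  moreover have "0 \<le> v (c' i)" if "i \<le> n" for i
  proof -
    have "v (c k) + Fin (- d) \<le> v (c i) + Fin (- d)" using k(2)[OF that] by (rule add_right_mono)
    thus ?thesis using v'[of i] v'[of k] \<open>v (c' k) = 0\<close> by simp
  qed
  moreover have "(\<Sum>i\<le>n. \<iota> (c' i) * x ^ i) = \<iota> (inverse (c k)) * (\<Sum>i\<le>n. \<iota> (c i) * x ^ i)"
    by (simp add: sum_distrib_left c'_def emb_mult algebra_simps)
  ultimately show ?thesis using that[of n c'] k(1) c(2) by auto
qed

text \<open>The hypotheses \<open>nonneg\<close> and \<open>pos\<close> say that \<open>R\<close>
  meets \<open>F\<close> in the valuation ring of \<open>v\<close>. Every nonzero \<open>x\<close>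
  has a positive power associated over \<open>R\<close> to an element of \<open>F\<close>, so the
  valuation of \<open>R\<close> can be written down directly with values in the divisible hull, by
  dividing values of \<open>v\<close>.\<close>

lemma valuation_of_valuation_ring:
  assumes R: "subring R" and total: "\<And>x. x \<in> R \<or> inverse x \<in> R"
    and nonneg: "\<And>a. 0 \<le> v a \<Longrightarrow> \<iota> a \<in> R"
    and pos: "\<And>a. 0 < v a \<Longrightarrow> a \<noteq> 0 \<Longrightarrow> inverse (\<iota> a) \<notin> R"
  shows "\<exists>u. valuation u \<and> (\<forall>a. u (\<iota> a) = v a) \<and> (\<forall>x. 0 \<le> u x \<longleftrightarrow> x \<in> R)"
proof -
  note R' = subring_closed[OF R]
  define unit where "unit x \<longleftrightarrow> x \<noteq> 0 \<and> x \<in> R \<and> inverse x \<in> R" for x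
  have unit_mult: "unit (x * y)" if "unit x" "unit y" for x y
    using that R'(4) by (auto simp: unit_def)
  have unit_inverse: "unit (inverse x)" if "unit x" for x
    using that by (auto simp: unit_def)
  have unit_power: "unit (x ^ n)" if "unit x" for x n
    using that R'(7) by (auto simp: unit_def power_inverse[symmetric])
  have emb_in_R: "\<iota> a \<in> R \<longleftrightarrow> 0 \<le> v a" if a: "v a = Fin g" for a g
  proof (cases "0 \<le> g")
    case True
    then show ?thesis using nonneg[of a] a by (simp add: zero_with_infinity_def)
  next
    case False
    hence "0 < v (inverse a)" using valuation_inverse[OF valuation a] by (simp add: zero_with_infinity_def)
    moreover have "a \<noteq> 0" using a valuation_eq_Infinity[OF valuation, of a] by auto
    ultimately have "\<iota> a \<notin> R" using pos[of "inverse a"] by (simp add: emb_inverse)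
    thus ?thesis using False a by (simp add: zero_with_infinity_def)
  qed
  have unit_emb: "v a = 0" if a: "unit (\<iota> a)" for a
  proof -
    have "a \<noteq> 0" using that by (auto simp: unit_def)
    then obtain g where g: "v a = Fin g"
      using valuation_eq_Infinity[OF valuation, of a] by (cases "v a") auto
    have "0 \<le> v a" "0 \<le> v (inverse a)"
      using a emb_in_R[OF g] emb_in_R[OF valuation_inverse[OF valuation g]]
      by (auto simp: unit_def emb_inverse)
    thus ?thesis using g valuation_inverse[OF valuation g] by (simp add: zero_with_infinity_def)
  qed
  \<comment> \<open>\<open>x\<^sup>n\<close> is associated to \<open>a\<close>, which forces \<open>d = v(a) / n\<close> to be the value of \<open>x\<close>\<close>
  define rel where "rel x d \<longleftrightarrow> (\<exists>n>0. \<exists>a. unit (x ^ n / \<iota> a) \<and> v a = Fin (nat_mult n d))" for x d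
  have rel_ex: "\<exists>d. rel x d" if x: "x \<noteq> 0" for x
  proof -
    \<comment> \<open>Divisibility over \<open>R\<close>, total because \<open>R\<close> is a
      valuation ring. A tie means association, so two tied monomials make \<open>x ^ (k - i)\<close>
      associated to \<open>\<iota> (a / b)\<close>.\<close>
    define le where "le y z \<longleftrightarrow> (\<exists>r\<in>R. z = y * r)" for y z
    have le1: "le y z \<or> le z y" for y z
    proof (cases "y = 0 \<or> z = 0")
      case True
      thus ?thesis using R'(2) by (auto simp: le_def)
    next
      case False
      hence "z = y * (z / y)" "y = z * inverse (z / y)" by auto
      thus ?thesis using total[of "z / y"] unfolding le_def by blast
    qed
    have le2: "le y z'" if "le y z" "le z z'" for y z z'
      using that R'(4) unfolding le_def by (metis mult.assoc)
    have le3: "le y (y + z)" if yz: "le y z" for y z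
    proof -
      obtain r where "r \<in> R" "z = y * r" using yz by (auto simp: le_def)
      hence "1 + r \<in> R" "y + z = y * (1 + r)" using R'(1,3) by (auto simp: algebra_simps)
      thus ?thesis unfolding le_def by blast
    qed
    have le4: "le y (- y)" for y
    proof -
      have "- 1 \<in> R" "- y = y * (- 1)" using R'(1,6) by auto
      thus ?thesis unfolding le_def by blast
    qed
    have le5: "z = 0" if "le 0 z" for z using that by (auto simp: le_def)
    obtain i k a b where *: "i < k" "a \<noteq> 0" "b \<noteq> 0"
        "le (\<iota> a * x ^ i) (\<iota> b * x ^ k)" "le (\<iota> b * x ^ k) (\<iota> a * x ^ i)"
      by (rule tied_monomials[of le x, OF le1 le2 le3 le4 le5 x])
    define y where "y = x ^ (k - i) / \<iota> (a / b)"
    have k: "x ^ k = x ^ i * x ^ (k - i)" using *(1) by (simp flip: power_add)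
    obtain r r' where r: "r \<in> R" "\<iota> b * x ^ k = \<iota> a * x ^ i * r"
        "r' \<in> R" "\<iota> a * x ^ i = \<iota> b * x ^ k * r'"
      using *(4,5) unfolding le_def by blast
    have "y = r" using r(2) x *(2,3) by (simp add: y_def k emb_divide field_simps)
    moreover have "inverse y = r'" using r(4) x *(2,3) by (simp add: y_def k emb_divide field_simps)
    moreover have "y \<noteq> 0" using x *(2,3) by (simp add: y_def)
    ultimately have "unit y" using r by (simp add: unit_def)
    moreover obtain g where g: "v (a / b) = Fin g"
      using valuation_eq_Infinity[OF valuation, of "a / b"] *(2,3) by (cases "v (a / b)") auto
    moreover obtain d where "nat_mult (k - i) d = g" using divisible[of "k - i" g] *(1) by auto
    ultimately show ?thesis unfolding rel_def y_def using *(1) by (metis zero_less_diff)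
  qed
  have rel_unique: "d = d'" if rels: "rel x d" "rel x d'" for x d d'
  proof -
    obtain n a where 1: "n > 0" "unit (x ^ n / \<iota> a)" "v a = Fin (nat_mult n d)"
      using rels(1) by (auto simp: rel_def)
    obtain m b where 2: "m > 0" "unit (x ^ m / \<iota> b)" "v b = Fin (nat_mult m d')"
      using rels(2) by (auto simp: rel_def)
    have nz: "x \<noteq> 0" "a \<noteq> 0" "b \<noteq> 0" using 1 2 by (auto simp: unit_def)
    \<comment> \<open>The crossed exponents cancel \<open>x\<close> and leave a unit of
      \<open>R\<close> that comes from \<open>F\<close>, hence has \<open>v\<close>-value
      \<open>0\<close>.\<close>
    have "unit ((x ^ m / \<iota> b) ^ n * inverse ((x ^ n / \<iota> a) ^ m))"
      using 1 2 by (intro unit_mult unit_inverse unit_power)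
    moreover have "(x ^ m / \<iota> b) ^ n * inverse ((x ^ n / \<iota> a) ^ m) = \<iota> (a ^ m / b ^ n)"
      using nz by (simp add: emb_divide emb_power power_divide field_simps flip: power_mult)
    ultimately have "v (a ^ m / b ^ n) = 0" using unit_emb by simp
    moreover have "v (a ^ m) = Fin (nat_mult m (nat_mult n d))"
        "v (b ^ n) = Fin (nat_mult n (nat_mult m d'))"
      using 1 2 by (simp_all add: valuation_power[OF valuation])
    ultimately have "nat_mult m (nat_mult n d) = nat_mult n (nat_mult m d')"
      using valuation_divide[OF valuation] by (simp add: zero_with_infinity_def)
    hence "nat_mult (m * n) d = nat_mult (m * n) d'"
      by (metis nat_mult_mult mult.commute)
    thus ?thesis using nat_mult_inj[of "m * n" d d'] 1(1) 2(1) by simp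
  qed
  have rel_mult: "rel (x * y) (d + d')" if rels: "rel x d" "rel y d'" for x y d d'
  proof -
    obtain n a where 1: "n > 0" "unit (x ^ n / \<iota> a)" "v a = Fin (nat_mult n d)"
      using rels(1) by (auto simp: rel_def)
    obtain m b where 2: "m > 0" "unit (y ^ m / \<iota> b)" "v b = Fin (nat_mult m d')"
      using rels(2) by (auto simp: rel_def)
    have "unit ((x ^ n / \<iota> a) ^ m * (y ^ m / \<iota> b) ^ n)"
      using 1 2 by (intro unit_mult unit_power)
    also have "(x ^ n / \<iota> a) ^ m * (y ^ m / \<iota> b) ^ n = (x * y) ^ (n * m) / \<iota> (a ^ m * b ^ n)"
      by (simp add: emb_mult emb_power power_divide power_mult_distrib mult.commute[of n m] flip: power_mult)
    finally have "unit ((x * y) ^ (n * m) / \<iota> (a ^ m * b ^ n))" .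
    moreover have "v (a ^ m * b ^ n) = Fin (nat_mult (n * m) (d + d'))"
      using 1 2 by (simp add: valuation_mult[OF valuation] valuation_power[OF valuation]
          nat_mult_distrib nat_mult_mult nat_mult_swap[of m n])
    ultimately show ?thesis using 1 2 unfolding rel_def by (metis nat_0_less_mult_iff)
  qed
  have rel_emb: "rel (\<iota> a) d" if "v a = Fin d" for a d
  proof -
    have "a \<noteq> 0" using that valuation_eq_Infinity[OF valuation, of a] by auto
    hence "unit (\<iota> a ^ Suc 0 / \<iota> a)" using R'(1) by (simp add: unit_def)
    thus ?thesis using that unfolding rel_def by (metis nat_mult_1 zero_less_Suc)
  qed
  \<comment> \<open>Valuation rings are closed under roots: if \<open>x \<notin> R\<close> then
    \<open>inverse x \<in> R\<close>, and \<open>x\<close> is \<open>x ^ n\<close> times a power of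
    \<open>inverse x\<close>.\<close>
  have root: "x \<in> R" if "n > 0" "x ^ n \<in> R" for x n
  proof (cases "x = 0 \<or> x \<in> R")
    case True
    thus ?thesis using R'(2) by auto
  next
    case False
    obtain k where k: "n = Suc k" using \<open>n > 0\<close> gr0_implies_Suc by blast
    have "x = x ^ n * inverse x ^ k" using False by (simp add: k power_inverse field_simps)
    thus ?thesis using R'(4,7) total[of x] that False by metis
  qed
  have rel_nonneg: "0 \<le> d \<longleftrightarrow> x \<in> R" if x: "rel x d" for x d
  proof -
    obtain n a where 1: "n > 0" "unit (x ^ n / \<iota> a)" "v a = Fin (nat_mult n d)"
      using x by (auto simp: rel_def)
    have nz: "\<iota> a \<noteq> 0" "x \<noteq> 0" using 1 by (auto simp: unit_def)
    have "0 \<le> d \<longleftrightarrow> 0 \<le> v a"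
      using 1 nat_mult_le_iff[of n 0 d] by (simp add: zero_with_infinity_def)
    also have "\<dots> \<longleftrightarrow> \<iota> a \<in> R" using emb_in_R[OF 1(3)] by simp
    also have "\<dots> \<longleftrightarrow> x ^ n \<in> R"
    proof
      have "x ^ n = \<iota> a * (x ^ n / \<iota> a)" using nz by simp
      thus "x ^ n \<in> R" if "\<iota> a \<in> R" using that 1 R'(4) unfolding unit_def by metis
      have "\<iota> a = x ^ n * inverse (x ^ n / \<iota> a)" using nz by simp
      thus "\<iota> a \<in> R" if "x ^ n \<in> R" using that 1 R'(4) unfolding unit_def by metis
    qed
    also have "\<dots> \<longleftrightarrow> x \<in> R" using root[OF 1(1)] R'(7) by blast
    finally show ?thesis .
  qed
  define u where "u x = (if x = 0 then Infinity else Fin (THE d. rel x d))" for x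
  have u_rel: "u x = Fin d" if "rel x d" for x d
  proof -
    have "x \<noteq> 0" using that by (auto simp: rel_def unit_def)
    thus ?thesis using that rel_unique by (auto simp: u_def intro!: the_equality)
  qed
  have u_mult: "u (x * y) = u x + u y" for x y
  proof (cases "x = 0 \<or> y = 0")
    case True
    thus ?thesis by (auto simp: u_def)
  next
    case False
    then obtain d d' where "rel x d" "rel y d'" using rel_ex by blast
    thus ?thesis using u_rel rel_mult by simp
  qed
  have u_nonneg: "0 \<le> u x \<longleftrightarrow> x \<in> R" for x
  proof (cases "x = 0")
    case True
    thus ?thesis using R'(2) by (auto simp: u_def)
  next
    case False
    then obtain d where "rel x d" using rel_ex by blast
    thus ?thesis using u_rel rel_nonneg by (simp add: zero_with_infinity_def)
  qed
  \<comment> \<open>If \<open>u x \<le> u y\<close> then \<open>y / x\<close> and hence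
    \<open>1 + y / x\<close> lie in \<open>R\<close>; multiplying by \<open>x\<close> restores
    \<open>x + y\<close>.\<close>
  have u_add: "u x \<le> u (x + y)" if xy: "u x \<le> u y" for x y
  proof (cases "x = 0")
    case True
    thus ?thesis using xy by (simp add: u_def)
  next
    case False
    then obtain d where d: "u x = Fin d" using rel_ex u_rel by blast
    have y: "y = x * (y / x)" using False by simp
    have "u y = u x + u (y / x)" using u_mult[of x "y / x"] y by simp
    hence "0 \<le> u (y / x)" using xy d by (cases "u (y / x)") (auto simp: zero_with_infinity_def)
    hence "0 \<le> u (1 + y / x)" using u_nonneg R'(1,3) by simp
    hence "u x + 0 \<le> u x + u (1 + y / x)" by (rule add_left_mono)
    also have "\<dots> = u (x + y)" using u_mult[of x "1 + y / x"] False by (simp add: distrib_left)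
    finally show ?thesis by simp
  qed
  have "min (u x) (u y) \<le> u (x + y)" for x y
    using u_add[of x y] u_add[of y x] by (cases "u x \<le> u y") (auto simp: add.commute)
  hence "valuation u" using u_mult by (auto simp: valuation_def u_def)
  moreover have "u (\<iota> a) = v a" for a
    using u_rel[OF rel_emb, of a] valuation_eq_Infinity[OF valuation, of a]
    by (cases "v a") (auto simp: u_def)
  ultimately show ?thesis using u_nonneg by blast
qed

section \<open>Shifting values by elements of the base field\<close>

lemma scale:
  fixes w :: "'e \<Rightarrow> 'd with_infinity"
  assumes w: "quasi_valuation w" and wv: "\<And>a. w (\<iota> a) = v a" and a: "v a = Fin d"
  shows "w (inverse (\<iota> a) * x) = w x + Fin (- d)"
proof -
  have va: "v (inverse a) = Fin (- d)" using valuation_inverse[OF valuation a] .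
  have "a \<noteq> 0" using a valuation_eq_Infinity[OF valuation, of a] by auto
  hence x: "x = \<iota> a * (inverse (\<iota> a) * x)" by simp
  have mult: "w y + w z \<le> w (y * z)" for y z using w by (simp add: quasi_valuation_def)
  \<comment> \<open>Supermultiplicativity for \<open>inverse a\<close> and for \<open>a\<close>
    gives the two inequalities, so elements of \<open>F\<close> shift \<open>w\<close>
    exactly.\<close>
  have "Fin (- d) + w x \<le> w (inverse (\<iota> a) * x)"
    using mult[of "\<iota> (inverse a)" x] wv[of "inverse a"] va by (simp add: emb_inverse)
  moreover have "Fin d + w (inverse (\<iota> a) * x) \<le> w x"
    using mult[of "\<iota> a" "inverse (\<iota> a) * x"] x by (simp add: wv a)
  ultimately show ?thesis
    by (cases "w x"; cases "w (inverse (\<iota> a) * x)") (auto simp: algebra_simps)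
qed

text \<open>Turns the comparison of \<open>w x\<close> with \<open>d\<close> into a comparison with
  \<open>0\<close>, which membership in \<open>{x. 0 \<le> w x}\<close> can detect;
  \<open>torsion\<close> supplies \<open>a\<close> and \<open>n\<close>.\<close>

lemma scale_power:
  fixes w :: "'e \<Rightarrow> 'd with_infinity"
  assumes w: "quasi_valuation w" "exponential w" and wv: "\<And>a. w (\<iota> a) = v a"
    and a: "v a = Fin (nat_mult n d)" and x: "w x = Fin d'"
  shows "w (inverse (\<iota> a) * x ^ n) = Fin (nat_mult n (d' - d))"
proof -
  have "w (x ^ n) = nat_mult n (w x)" using w(2) by (simp add: exponential_def)
  thus ?thesis using scale[OF w(1) wv a, of "x ^ n"] x
      nat_mult_distrib[of n "d'" "- d"] by (simp add: nat_mult_uminus)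
qed

text \<open>The valuation ring of \<open>u\<close> is the localization of
  \<open>{x. 0 \<le> w x}\<close> at a prime ideal that contains all elements of positive value but
  not \<open>y\<close>.\<close>

lemma separating_valuation:
  fixes w :: "'e \<Rightarrow> 'd with_infinity"
  assumes w: "quasi_valuation w" "exponential w" and wv: "\<And>a. w (\<iota> a) = v a" and y: "w y = 0"
  shows "\<exists>u. valuation u \<and> (\<forall>a. u (\<iota> a) = v a) \<and> (\<forall>x. 0 \<le> w x \<longrightarrow> 0 \<le> u x) \<and> u y = 0"
proof -
  define R where "R = {x. 0 \<le> w x}"
  note R = subring_nonneg[OF w, folded R_def]
  note R' = subring_closed[OF R]
  have "w (y ^ n) = 0" for n using w(2) y by (simp add: exponential_def)
  then obtain P where P: "prime_ideal R P" "{x. 0 < w x} \<subseteq> P" "y \<notin> P"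
    using prime_ideal_avoiding_powers[OF R ideal_pos[OF w, folded R_def], of y] y
    by (auto simp: R_def)
  have P': "additive_subgroup P" "1 \<notin> P" "0 \<in> P" "\<And>r p. r \<in> R \<Longrightarrow> p \<in> P \<Longrightarrow> r * p \<in> P"
    using P(1) by (auto simp: prime_ideal_def ideal_def additive_subgroup_def)
  define L where "L = localization R P"
  note L = subring_localization[OF R P(1), folded L_def]
    localization_unit[OF R P(1), folded L_def] localization_contains[OF R P(1), folded L_def]
  have ratio: "r / s \<in> L" if "r \<in> R" "s \<in> R" "s \<notin> P" for r s
    using that unfolding L_def localization_def by blast
  \<comment> \<open>A coefficient of value \<open>0\<close> is a unit of \<open>R\<close>, hence
    outside \<open>P\<close>. The resulting \<open>s\<close> has \<open>s \<notin> P\<close> or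
    \<open>s * x \<notin> P\<close>, and accordingly \<open>x\<close> or \<open>inverse x\<close> is
    a fraction with that denominator.\<close>
  have total: "x \<in> L \<or> inverse x \<in> L" for x
  proof -
    obtain n c where c: "\<And>i. i \<le> n \<Longrightarrow> 0 \<le> v (c i)" "\<exists>i\<le>n. v (c i) = 0"
        "(\<Sum>i\<le>n. \<iota> (c i) * x ^ i) = 0"
      using normalized_relation by blast
    obtain k where k: "k \<le> n" "v (c k) = 0" using c(2) by blast
    have "c k \<noteq> 0" using k(2) valuation_eq_Infinity[OF valuation, of "c k"]
      by (auto simp: zero_with_infinity_def)
    have "v (inverse (c k)) = Fin (- 0)"
      using k(2) by (intro valuation_inverse[OF valuation]) (simp add: zero_with_infinity_def)
    hence "\<iota> (inverse (c k)) \<in> R" by (simp add: R_def wv zero_with_infinity_def)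
    hence "\<iota> (c k) \<notin> P"
      using P'(2,4) \<open>c k \<noteq> 0\<close> by (metis emb_inverse emb_eq_0_iff left_inverse)
    moreover have "\<iota> (c i) \<in> R" if "i \<le> n" for i using c(1)[OF that] by (simp add: R_def wv)
    ultimately obtain s where s: "s \<in> R" "s * x \<in> R" "s \<notin> P \<or> s * x \<notin> P"
      using integral_fraction[OF R integrally_closed_nonneg[OF w, folded R_def] P'(1),
          of n "\<lambda>i. \<iota> (c i)" x] c(3) k(1) by blast
    show ?thesis
    proof (cases "s \<in> P")
      case False
      hence "x = (s * x) / s" using P'(3) by auto
      thus ?thesis using ratio s False by metis
    next
      case True
      hence *: "s * x \<notin> P" using s by blast
      hence "inverse x = s / (s * x)" using P'(3) by (auto simp: field_simps)
      thus ?thesis using ratio s * by metis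
    qed
  qed
  have "\<exists>u. valuation u \<and> (\<forall>a. u (\<iota> a) = v a) \<and> (\<forall>x. 0 \<le> u x \<longleftrightarrow> x \<in> L)"
  proof (rule valuation_of_valuation_ring[OF L(1) total])
    show "\<iota> a \<in> L" if "0 \<le> v a" for a using that by (intro L(3)) (simp add: R_def wv)
    \<comment> \<open>Elements of \<open>F\<close> of positive value lie in \<open>P\<close>, so
      they do not become units in \<open>L\<close>.\<close>
    show "inverse (\<iota> a) \<notin> L" if "0 < v a" "a \<noteq> 0" for a
      using that P(2) by (intro L(2)) (auto simp: wv)
  qed
  then obtain u where u: "valuation u" "\<And>a. u (\<iota> a) = v a" "\<And>x. 0 \<le> u x \<longleftrightarrow> x \<in> L" by blast
  \<comment> \<open>Both \<open>y\<close> and its inverse lie in \<open>L\<close>, because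
    \<open>y \<notin> P\<close>.\<close>
  have "u y = 0"
  proof -
    have yR: "y \<in> R" using y by (simp add: R_def)
    hence "0 \<le> u y" using u(3) L(3) by blast
    have "1 / y \<in> L" using ratio yR P(3) R'(1) by blast
    hence "0 \<le> u (inverse y)" using u(3) by (simp add: divide_inverse)
    moreover have "y \<noteq> 0" using P(3) P'(3) by auto
    then obtain d where d: "u y = Fin d"
      using valuation_eq_Infinity[OF u(1), of y] by (cases "u y") auto
    ultimately show ?thesis using \<open>0 \<le> u y\<close> valuation_inverse[OF u(1) d]
      by (simp add: zero_with_infinity_def)
  qed
  thus ?thesis using u L(3) by (auto simp: R_def)
qed

section \<open>Finiteness of the set of extensions\<close>

definition extensions :: "('e \<Rightarrow> 'd with_infinity) set" where
  "extensions = {u. valuation u \<and> (\<forall>a. u (\<iota> a) = v a)}"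

text \<open>Where \<open>u\<close> and \<open>u'\<close> differ, passing to the inverse if necessary
  makes \<open>u\<close> the smaller; \<open>scale_power\<close> then shifts its value to
  \<open>0\<close> and leaves that of \<open>u'\<close> positive.\<close>

lemma extensions_separated:
  assumes u: "u \<in> extensions" "u' \<in> extensions" "u \<noteq> u'"
  shows "\<exists>x. u x = 0 \<and> 0 < u' x"
proof -
  have val: "valuation u" "valuation u'" and uv: "\<And>a. u (\<iota> a) = v a" "\<And>a. u' (\<iota> a) = v a"
    using u by (auto simp: extensions_def)
  obtain x where x: "u x \<noteq> u' x" using u(3) by blast
  have "x \<noteq> 0" using x valuation_eq_Infinity[OF val(1), of x] valuation_eq_Infinity[OF val(2), of x] by auto
  then obtain d d' where d: "u x = Fin d" "u' x = Fin d'"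
    using valuation_eq_Infinity[OF val(1), of x] valuation_eq_Infinity[OF val(2), of x]
    by (cases "u x"; cases "u' x") auto
  have "\<exists>x d d'. u x = Fin d \<and> u' x = Fin d' \<and> d < d'"
  proof (cases "d < d'")
    case False
    hence "- d < - d'" using x d by auto
    thus ?thesis using valuation_inverse[OF val(1) d(1)] valuation_inverse[OF val(2) d(2)] by blast
  qed (use d in blast)
  then obtain x d d' where d: "u x = Fin d" "u' x = Fin d'" "d < d'" by blast
  obtain n a where n: "n > 0" "v a = Fin (nat_mult n d)" using torsion by blast
  note q = valuation_imp_quasi_valuation valuation_imp_exponential
  have "u (inverse (\<iota> a) * x ^ n) = 0"
    using scale_power[OF q[OF val(1)] uv(1) n(2) d(1)] by (simp add: zero_with_infinity_def)
  moreover have "u' (inverse (\<iota> a) * x ^ n) = Fin (nat_mult n (d' - d))"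
    using scale_power[OF q[OF val(2)] uv(2) n(2) d(2)] .
  moreover have "0 < nat_mult n (d' - d)" using nat_mult_less_iff[OF n(1), of 0 "d' - d"] d(3) by simp
  ultimately show ?thesis by (auto simp: zero_with_infinity_def intro!: exI[of _ "inverse (\<iota> a) * x ^ n"])
qed

text \<open>A separating \<open>x\<close> may be negative at other members of \<open>V\<close>.
  Applying \<open>integral_fraction\<close> to the intersection of the valuation rings and to
  \<open>{x. 0 < u x}\<close> gives a multiplier \<open>s\<close>; since \<open>u x = 0\<close>,
  both \<open>s\<close> and \<open>s * x\<close> get \<open>u\<close>-value
  \<open>0\<close>.\<close>

lemma extensions_separated_nonneg:
  assumes V: "V \<subseteq> extensions" and u: "u \<in> V" "u' \<in> V" "u \<noteq> u'"
  shows "\<exists>x. (\<forall>u\<in>V. 0 \<le> u x) \<and> u x = 0 \<and> 0 < u' x"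
proof -
  have val: "valuation u" and uv: "u (\<iota> a) = v a" if "u \<in> V" for u a
    using that V by (auto simp: extensions_def)
  define R where "R = {x. \<forall>u\<in>V. 0 \<le> u x}"
  have R1: "subring {x. 0 \<le> u x}" "integrally_closed {x. 0 \<le> u x}" if "u \<in> V" for u
    using valuation_imp_quasi_valuation[OF val[OF that]] valuation_imp_exponential[OF val[OF that]]
    by (auto intro: subring_nonneg integrally_closed_nonneg)
  have R: "subring R"
    using R1(1) unfolding R_def subring_def by auto
  have R2: "integrally_closed R"
    unfolding integrally_closed_def
  proof (intro allI impI)
    fix x n c assume "0 < n \<and> (\<forall>i<n. c i \<in> R) \<and> x ^ n = (\<Sum>i<n. c i * x ^ i)"
    hence "x \<in> {x. 0 \<le> u x}" if "u \<in> V" for u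
      using R1(2)[OF that] that unfolding integrally_closed_def R_def by blast
    thus "x \<in> R" by (simp add: R_def)
  qed
  obtain x where x: "u x = 0" "0 < u' x" using extensions_separated u V by blast
  obtain n c where c: "\<And>i. i \<le> n \<Longrightarrow> 0 \<le> v (c i)" "\<exists>i\<le>n. v (c i) = 0"
      "(\<Sum>i\<le>n. \<iota> (c i) * x ^ i) = 0"
    using normalized_relation by blast
  have P: "additive_subgroup {x. 0 < u x}"
    using ideal_pos[OF valuation_imp_quasi_valuation[OF val[OF u(1)]]
        valuation_imp_exponential[OF val[OF u(1)]]] by (simp add: ideal_def)
  have "\<iota> (c i) \<in> R" if "i \<le> n" for i using c(1)[OF that] by (simp add: R_def uv)
  moreover have "\<exists>i\<le>n. \<iota> (c i) \<notin> {x. 0 < u x}" using c(2) uv[OF u(1)] by auto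
  ultimately obtain s where s: "s \<in> R" "s * x \<in> R" "\<not> 0 < u s \<or> \<not> 0 < u (s * x)"
    using integral_fraction[OF R R2 P, of n "\<lambda>i. \<iota> (c i)" x] c(3) by blast
  have "u (s * x) = u s" using x(1) by (simp add: valuation_mult[OF val[OF u(1)]])
  hence "u (s * x) = 0" using s u(1) by (auto simp: R_def)
  moreover have "0 < u' (s * x)"
  proof -
    have "u' x = 0 + u' x" by simp
    also have "\<dots> \<le> u' s + u' x" using s(1) u(2) by (intro add_right_mono) (auto simp: R_def)
    finally show ?thesis using x(2) by (simp add: valuation_mult[OF val[OF u(2)]])
  qed
  ultimately show ?thesis using s(2) by (auto simp: R_def)
qed

text \<open>The element is a product of separating elements, one for each
  \<open>u' \<noteq> u\<close>.\<close>

lemma extensions_approximation: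
  assumes V: "V \<subseteq> extensions" "finite V" and u: "u \<in> V"
  shows "\<exists>x. u x = 0 \<and> (\<forall>u'\<in>V - {u}. 0 < u' x)"
proof -
  have val: "valuation u" if "u \<in> V" for u using that V by (auto simp: extensions_def)
  \<comment> \<open>Nonnegativity on the whole of \<open>V\<close> goes into the induction so that a
    further factor never lowers a value already made positive.\<close>
  have "\<exists>x. (\<forall>u'\<in>V. 0 \<le> u' x) \<and> u x = 0 \<and> (\<forall>u'\<in>W. 0 < u' x)" if W: "W \<subseteq> V - {u}" for W
    using finite_subset[OF W finite_Diff[OF V(2)]] W
  proof (induction W rule: finite_induct)
    case empty
    have "u' 1 = 0" if "u' \<in> V" for u' using valuation_1[OF val[OF that]] .
    thus ?case using u by (intro exI[of _ 1]) fastforce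
  next
    case (insert u1 W)
    obtain x where x: "\<And>u'. u' \<in> V \<Longrightarrow> 0 \<le> u' x" "u x = 0" "\<And>u'. u' \<in> W \<Longrightarrow> 0 < u' x"
      using insert by auto
    obtain y where y: "\<And>u'. u' \<in> V \<Longrightarrow> 0 \<le> u' y" "u y = 0" "0 < u1 y"
      using extensions_separated_nonneg[OF V(1) u, of u1] insert.prems by auto
    have *: "u' x \<le> u' (x * y)" "u' y \<le> u' (x * y)" "0 \<le> u' (x * y)" if "u' \<in> V" for u'
      using x(1)[OF that] y(1)[OF that] valuation_mult[OF val[OF that], of x y]
        add_left_mono[of 0 "u' y" "u' x"] add_right_mono[of 0 "u' x" "u' y"] by auto
    have "0 < u' (x * y)" if "u' \<in> insert u1 W" for u'
    proof -
      have "u' \<in> V" using that insert.prems by auto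
      thus ?thesis using that x(3)[of u'] y(3) *(1,2)[of u'] by (auto intro: less_le_trans)
    qed
    moreover have "u (x * y) = 0" using valuation_mult[OF val[OF u]] x(2) y(2) by simp
    ultimately show ?case using *(3) by blast
  qed
  from this[OF order_refl] show ?thesis by blast
qed

text \<open>
  The elements \<open>x\<^sub>u\<close> with \<open>u(x\<^sub>u) = 0\<close> and \<open>u'(x\<^sub>u) > 0\<close> for \<open>u' \<noteq> u\<close> are linearly independent over the
  base field.
\<close>

lemma finite_extensions: "finite extensions"
proof (rule ccontr)
  obtain N where N: "\<And>(x :: ('e \<Rightarrow> 'd with_infinity) \<Rightarrow> 'e) I. finite I \<Longrightarrow> N < card I \<Longrightarrow>
      \<exists>c. (\<exists>i\<in>I. c i \<noteq> 0) \<and> (\<Sum>i\<in>I. \<iota> (c i) * x i) = 0"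
    using dependent_family by blast
  assume "infinite extensions"
  then obtain V where V: "finite V" "card V = Suc N" "V \<subseteq> extensions"
    using infinite_arbitrarily_large by metis
  have "\<exists>x. \<forall>u\<in>V. u (x u) = 0 \<and> (\<forall>u'\<in>V - {u}. 0 < u' (x u))"
    using extensions_approximation[OF V(3,1)] by (intro bchoice) blast
  then obtain x where x: "\<And>u. u \<in> V \<Longrightarrow> u (x u) = 0"
      "\<And>u u'. u \<in> V \<Longrightarrow> u' \<in> V \<Longrightarrow> u' \<noteq> u \<Longrightarrow> 0 < u' (x u)"
    by auto
  obtain c where c: "\<exists>u\<in>V. c u \<noteq> 0" "(\<Sum>u\<in>V. \<iota> (c u) * x u) = 0"
    using N[OF V(1), of x] V(2) by auto
  \<comment> \<open>For \<open>u\<close> with a coefficient of least value, the term at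
    \<open>u\<close> has \<open>u\<close>-value exactly \<open>v (c u)\<close>, whereas all other
    terms have larger \<open>u\<close>-value; such a sum cannot vanish.\<close>
  obtain u where u: "u \<in> V" "\<And>u'. u' \<in> V \<Longrightarrow> v (c u) \<le> v (c u')"
    using ex_min_if_finite[of "(\<lambda>u. v (c u)) ` V"] V(1,2) by (force simp: not_less)
  have vc: "v (c u) \<noteq> Infinity"
    using u(2) c(1) valuation_eq_Infinity[OF valuation] by (metis Infinity_le_iff)
  have val: "valuation u" and uv: "\<And>a. u (\<iota> a) = v a"
    using u(1) V(3) by (auto simp: extensions_def)
  note qval = valuation_imp_quasi_valuation[OF val] valuation_imp_exponential[OF val]
  have "v (c u) < u (\<Sum>u'\<in>V - {u}. \<iota> (c u') * x u')"
  proof (rule quasi_valuation_sum_less[OF qval(1) vc])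
    fix u' assume u': "u' \<in> V - {u}"
    have "v (c u) \<le> v (c u')" "0 < u (x u')" using u' u x(2)[of u' u] by auto
    moreover have "a < b + c" if "a \<le> b" "0 < c" for a b c :: 'd
      using add_le_less_mono[OF that] by simp
    ultimately show "v (c u) < u (\<iota> (c u') * x u')" using vc
      by (cases "v (c u)"; cases "v (c u')"; cases "u (x u')")
        (auto simp: valuation_mult[OF val] uv zero_with_infinity_def)
  qed (use V(1) in auto)
  also have "(\<Sum>u'\<in>V - {u}. \<iota> (c u') * x u') = - (\<iota> (c u) * x u)"
    using c(2) sum.remove[OF V(1) u(1), of "\<lambda>u. \<iota> (c u) * x u"]
    by (simp add: eq_neg_iff_add_eq_0 add.commute)
  finally show False
    using x(1)[OF u(1)] by (simp add: quasi_valuation_uminus[OF qval] valuation_mult[OF val] uv)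
qed

section \<open>The quasi-valuation as a minimum of extensions\<close>

theorem exponential_eq_Min:
  fixes w :: "'e \<Rightarrow> 'd with_infinity"
  assumes w: "quasi_valuation w" "exponential w" and wv: "\<And>a. w (\<iota> a) = v a"
  shows "\<exists>U\<subseteq>extensions. finite U \<and> U \<noteq> {} \<and> (\<forall>x. w x = Min ((\<lambda>u. u x) ` U))"
proof -
  \<comment> \<open>All extensions dominating \<open>w\<close> are taken. They are finitely many, so
    it remains to find, for each point, one that agrees with \<open>w\<close> there.\<close>
  define U where "U = {u \<in> extensions. \<forall>x. w x \<le> u x}"
  have attained: "\<exists>u\<in>U. u x = w x" if x: "x \<noteq> 0" for x
  proof -
    obtain d where d: "w x = Fin d" using quasi_valuation_not_Infinity[OF w x] by (cases "w x") auto
    obtain n a where n: "n > 0" "v a = Fin (nat_mult n d)" using torsion by blast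
    have "w (inverse (\<iota> a) * x ^ n) = 0"
      using scale_power[OF w wv n(2) d] by (simp add: zero_with_infinity_def)
    then obtain u where u: "valuation u" "\<And>a. u (\<iota> a) = v a" "\<And>x. 0 \<le> w x \<Longrightarrow> 0 \<le> u x"
        "u (inverse (\<iota> a) * x ^ n) = 0"
      using separating_valuation[OF w wv] by blast
    note qval = valuation_imp_quasi_valuation[OF u(1)] valuation_imp_exponential[OF u(1)]
    \<comment> \<open>So far \<open>u\<close> is only known to be nonnegative where \<open>w\<close>
      is. Scaling a power of \<open>y\<close> to \<open>w\<close>-value \<open>0\<close> turns this
      into a comparison of values.\<close>
    have "w y \<le> u y" for y
    proof (cases "y = 0")
      case True
      thus ?thesis using qval(1) by (simp add: quasi_valuation_def)
    next
      case False
      then obtain e e' where e: "w y = Fin e" "u y = Fin e'"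
        using quasi_valuation_not_Infinity[OF w, of y] quasi_valuation_not_Infinity[OF qval, of y]
        by (cases "w y"; cases "u y") auto
      obtain m b where m: "m > 0" "v b = Fin (nat_mult m e)" using torsion by blast
      have "0 \<le> w (inverse (\<iota> b) * y ^ m)"
        using scale_power[OF w wv m(2) e(1)] by (simp add: zero_with_infinity_def)
      hence "0 \<le> u (inverse (\<iota> b) * y ^ m)" by (rule u(3))
      thus ?thesis using scale_power[OF qval u(2) m(2) e(2)] nat_mult_le_iff[OF m(1), of 0 "e' - e"] e
        by (simp add: zero_with_infinity_def)
    qed
    moreover obtain d' where d': "u x = Fin d'"
      using quasi_valuation_not_Infinity[OF qval x] by (cases "u x") auto
    hence "nat_mult n (d' - d) = nat_mult n 0"
      using scale_power[OF qval u(2) n(2) d'] u(4) by (simp add: zero_with_infinity_def)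
    hence "d' = d" using nat_mult_inj[OF n(1)] by fastforce
    ultimately show ?thesis using u d d' by (auto simp: U_def extensions_def)
  qed
  have fin: "finite U" using finite_extensions by (simp add: U_def)
  have ne: "U \<noteq> {}" using attained[of 1] by auto
  have "w x = Min ((\<lambda>u. u x) ` U)" for x
  proof (rule Min_eqI[symmetric])
    show "w x \<in> (\<lambda>u. u x) ` U"
    proof (cases "x = 0")
      case True
      \<comment> \<open>At \<open>0\<close> all values are \<open>Infinity\<close>, so any member of
        the nonempty set \<open>U\<close> serves.\<close>
      have "w x = u x" if "u \<in> U" for u
        using that w(1) valuation_eq_Infinity[of u x] True
        by (auto simp: U_def extensions_def quasi_valuation_def)
      thus ?thesis using ne by auto
    next
      case False
      thus ?thesis using attained[of x] unfolding image_iff by metis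
    qed
  qed (use fin in \<open>auto simp: U_def\<close>)
  moreover have "U \<subseteq> extensions" by (auto simp: U_def)
  ultimately show ?thesis using fin ne by blast
qed

end

section \<open>Embedding the value monoid\<close>

lemma
  assumes "ordered_monoid_embedding S f" "a \<in> S" "b \<in> S"
  shows ordered_monoid_embedding_add: "f (a + b) = f a + f b"
    and ordered_monoid_embedding_le_iff: "f a \<le> f b \<longleftrightarrow> a \<le> b"
    and ordered_monoid_embedding_eq_iff: "f a = f b \<longleftrightarrow> a = b"
proof -
  have mono: "strict_mono_on S f" and "f (a + b) = f a + f b"
    using assms by (auto simp: ordered_monoid_embedding_def)
  thus "f (a + b) = f a + f b" by simp
  show le: "f a \<le> f b \<longleftrightarrow> a \<le> b"
    using strict_mono_onD[OF mono, of a b] strict_mono_onD[OF mono, of b a] assms(2,3)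
    by (cases a b rule: linorder_cases) auto
  show "f a = f b \<longleftrightarrow> a = b"
    using strict_mono_onD[OF mono, of a b] strict_mono_onD[OF mono, of b a] assms(2,3)
    by (cases a b rule: linorder_cases) auto
qed

lemma valuation_map:
  fixes v :: "'k::field \<Rightarrow> 'g::linordered_ab_group_add with_infinity"
  assumes v: "valuation v" and j: "ordered_monoid_embedding (value_set v) j"
  shows "valuation (\<lambda>x. map_with_infinity j (v x) :: 'd::linordered_ab_group_add with_infinity)"
proof -
  \<comment> \<open>The map \<open>j\<close> is additive and increasing only on the value group, so
    finite values are always presented as members of \<open>value_set v\<close>.\<close>
  have val_cases: "v x = Infinity \<and> x = 0 \<or> (\<exists>a\<in>value_set v. x \<noteq> 0 \<and> v x = Fin a)" for x
    using valuation_eq_Infinity[OF v, of x] by (cases "v x") (auto simp: value_set_def)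
  note add = ordered_monoid_embedding_add[OF j] and mono = ordered_monoid_embedding_le_iff[OF j]
  have le: "map_with_infinity j (v x) \<le> map_with_infinity j (v y) \<longleftrightarrow> v x \<le> v y" for x y
    using val_cases[of x] val_cases[of y] mono by auto
  have "map_with_infinity j (v (x * y)) = map_with_infinity j (v x) + map_with_infinity j (v y)" for x y
    using val_cases[of x] val_cases[of y] add by (auto simp: valuation_mult[OF v])
  moreover have "min (map_with_infinity j (v x)) (map_with_infinity j (v y)) \<le> map_with_infinity j (v (x + y))" for x y
    using valuation_add[OF v, of x y] le[of x y] le[of x "x + y"] le[of y "x + y"]
    by (auto simp: min_def split: if_splits)
  moreover have "map_with_infinity j (v x) = Infinity \<longleftrightarrow> x = 0" for x
    using val_cases[of x] by auto
  ultimately show ?thesis by (auto simp: valuation_def)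
qed

lemma submonoid_value_set:
  assumes "valuation v"
  shows "submonoid (value_set v)"
  unfolding submonoid_def
proof (intro conjI ballI)
  show "0 \<in> value_set v" using valuation_1[OF assms]
    by (auto simp: value_set_def zero_with_infinity_def intro: exI[of _ 1])
  fix a b assume "a \<in> value_set v" "b \<in> value_set v"
  then obtain x y where "x \<noteq> 0" "v x = Fin a" "y \<noteq> 0" "v y = Fin b" by (auto simp: value_set_def)
  thus "a + b \<in> value_set v" using valuation_mult[OF assms, of x y]
    by (auto simp: value_set_def intro: exI[of _ "x * y"])
qed

lemma uminus_value_set:
  assumes v: "valuation v" and a: "a \<in> value_set v"
  shows "- a \<in> value_set v"
proof -
  obtain x where "x \<noteq> 0" "v x = Fin a" using a by (auto simp: value_set_def)
  thus ?thesis using valuation_inverse[OF v, of x a]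
    by (auto simp: value_set_def intro: exI[of _ "inverse x"])
qed

text \<open>
  In the relation \<open>i w(x) + \<phi>(\<gamma>) = k w(x) + \<phi>(\<delta>)\<close> between two tied monomials, \<open>i w(x)\<close> can be
  cancelled only in the form that weak cancellation permits.
\<close>

lemma value_set_torsion:
  fixes \<iota> :: "'f::field \<Rightarrow> 'e::field"
    and v :: "'f \<Rightarrow> 'g::linordered_ab_group_add with_infinity"
    and w :: "'e \<Rightarrow> 'm::{linorder, ordered_comm_monoid_add} with_infinity"
  assumes ext: "finite_field_extension \<iota>" and v: "valuation v"
    and w: "quasi_valuation w" "exponential w" and wv: "extends_valuation \<iota> \<phi> v w"
    and canc: "weakly_cancellative (value_monoid w)"
    and m: "m \<in> value_set w"
  shows "\<exists>n>0. \<exists>\<gamma>\<in>value_set v. nat_mult n m = \<phi> \<gamma>"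
proof -
  interpret field_extension \<iota> using ext by unfold_locales
  obtain x where x: "x \<noteq> 0" "w x = Fin m" using m by (auto simp: value_set_def)
  have phi: "ordered_monoid_embedding (value_set v) \<phi>" and w_emb: "w (\<iota> a) = map_with_infinity \<phi> (v a)" for a
    using wv by (auto simp: extends_valuation_def)
  note phi_add = ordered_monoid_embedding_add[OF phi]
  have w_mult: "w y + w z \<le> w (y * z)" for y z using w(1) by (simp add: quasi_valuation_def)
  \<comment> \<open>Elements of \<open>F\<close> have invertible values: multiplying by
    \<open>a\<close> and back by its inverse gives both inequalities without cancelling in the
    monoid.\<close>
  have monomial: "w (\<iota> a * x ^ i) = Fin (\<phi> \<gamma> + nat_mult i m)" if a: "v a = Fin \<gamma>" for a i \<gamma>
  proof -
    have a0: "a \<noteq> 0" using a valuation_eq_Infinity[OF v, of a] by auto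
    hence \<gamma>: "\<gamma> \<in> value_set v" using a by (auto simp: value_set_def)
    have "\<phi> \<gamma> + \<phi> (- \<gamma>) = 0"
      using phi_add[OF \<gamma> uminus_value_set[OF v \<gamma>]] phi by (simp add: ordered_monoid_embedding_def)
    have xi: "w (x ^ i) = Fin (nat_mult i m)" using w(2) x(2) by (simp add: exponential_def)
    have "Fin (\<phi> \<gamma>) + Fin (nat_mult i m) \<le> w (\<iota> a * x ^ i)"
      using w_mult[of "\<iota> a" "x ^ i"] by (simp add: w_emb a xi)
    moreover have "Fin (\<phi> (- \<gamma>)) + w (\<iota> a * x ^ i) \<le> Fin (nat_mult i m)"
    proof -
      have "w (inverse (\<iota> a)) = Fin (\<phi> (- \<gamma>))"
        using w_emb[of "inverse a"] by (simp add: valuation_inverse[OF v a] emb_inverse)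
      moreover have "inverse (\<iota> a) * (\<iota> a * x ^ i) = x ^ i" using a0 by (simp flip: mult.assoc)
      ultimately show ?thesis using w_mult[of "inverse (\<iota> a)" "\<iota> a * x ^ i"] xi by metis
    qed
    hence "Fin (\<phi> \<gamma>) + (Fin (\<phi> (- \<gamma>)) + w (\<iota> a * x ^ i)) \<le> Fin (\<phi> \<gamma>) + Fin (nat_mult i m)"
      by (rule add_left_mono)
    hence "w (\<iota> a * x ^ i) \<le> Fin (\<phi> \<gamma>) + Fin (nat_mult i m)"
      using \<open>\<phi> \<gamma> + \<phi> (- \<gamma>) = 0\<close>
      by (simp only: add.assoc[symmetric] plus_with_infinity.simps zero_with_infinity_def[symmetric] add_0)
    ultimately show ?thesis by simp
  qed
  have "\<exists>i k a b. i < k \<and> a \<noteq> 0 \<and> b \<noteq> 0 \<and> w (\<iota> a * x ^ i) = w (\<iota> b * x ^ k)"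
    (is ?tied)
  proof (rule tied_monomials[of "\<lambda>y z. w y \<le> w z" x])
    show "w y \<le> w (y + z)" if "w y \<le> w z" for y z
    proof -
      have "min (w y) (w z) \<le> w (y + z)" using w(1) unfolding quasi_valuation_def by blast
      thus ?thesis using that by (simp add: min_def)
    qed
    show "y = 0" if "w 0 \<le> w y" for y
      using that w(1) quasi_valuation_not_Infinity[OF w, of y] by (auto simp: quasi_valuation_def)
    show ?tied if "i < k" "a \<noteq> 0" "b \<noteq> 0" "w (\<iota> a * x ^ i) \<le> w (\<iota> b * x ^ k)"
      "w (\<iota> b * x ^ k) \<le> w (\<iota> a * x ^ i)" for i k a b
      using that order_antisym by blast
  qed (use x quasi_valuation_uminus[OF w] in auto)
  then obtain i k a b where ik: "i < k" "a \<noteq> 0" "b \<noteq> 0" "w (\<iota> a * x ^ i) = w (\<iota> b * x ^ k)"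
    by blast
  obtain \<gamma> \<delta> where ab: "v a = Fin \<gamma>" "v b = Fin \<delta>"
    using ik(2,3) valuation_eq_Infinity[OF v] by (metis with_infinity.exhaust)
  hence G: "\<gamma> \<in> value_set v" "\<delta> \<in> value_set v" using ik by (auto simp: value_set_def)
  note G' = uminus_value_set[OF v G(1)] uminus_value_set[OF v G(2)]
  have G'': "\<gamma> + - \<delta> \<in> value_set v" "\<delta> + - \<gamma> \<in> value_set v"
    using submonoid_value_set[OF v] G G' by (auto simp: submonoid_def simp del: add_uminus_conv_diff)
  have phi_neg: "\<phi> g + \<phi> (- g) = 0" if "g \<in> value_set v" for g
    using phi_add[OF that uminus_value_set[OF v that]] phi by (simp add: ordered_monoid_embedding_def)
  have eq: "\<phi> \<gamma> + nat_mult i m = \<phi> \<delta> + nat_mult k m" using ik(4) ab by (simp add: monomial)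
  have "nat_mult i m = \<phi> (- \<gamma>) + (\<phi> \<gamma> + nat_mult i m)"
    using phi_neg[OF G(1)] by (metis add.assoc add.commute add_0)
  also have "\<dots> = \<phi> (- \<gamma>) + (\<phi> \<delta> + nat_mult (i + (k - i)) m)" using eq ik(1) by simp
  also have "\<dots> = nat_mult i m + (\<phi> (\<delta> + - \<gamma>) + nat_mult (k - i) m)"
    unfolding nat_mult_add phi_add[OF G(2) G'(1)] by (simp only: ac_simps)
  \<comment> \<open>The relation now has the form \<open>s + t = s\<close> with
    \<open>s = nat_mult i m\<close>, so weak cancellation yields \<open>t = 0\<close>.\<close>
  finally have *: "nat_mult i m + (\<phi> (\<delta> + - \<gamma>) + nat_mult (k - i) m) = nat_mult i m" by simp
  have S: "submonoid (value_monoid w)" by (rule submonoid_value_monoid)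
  have "m \<in> value_monoid w" using m unfolding value_monoid_def by (rule hull_inc)
  hence mult: "nat_mult i m \<in> value_monoid w" for i
    using S by (induction i) (auto simp: submonoid_def nat_mult_Suc)
  moreover have "\<phi> (\<delta> + - \<gamma>) \<in> value_monoid w"
    using extends_value_set[OF ext wv G''(2)] .
  ultimately have "\<phi> (\<delta> + - \<gamma>) + nat_mult (k - i) m = 0"
    using * canc S unfolding weakly_cancellative_def submonoid_def by metis
  hence "\<phi> (\<gamma> + - \<delta>) + \<phi> (\<delta> + - \<gamma>) + nat_mult (k - i) m = \<phi> (\<gamma> + - \<delta>)"
    by (simp only: add.assoc add_0_right)
  hence "nat_mult (k - i) m = \<phi> (\<gamma> + - \<delta>)"
    using phi_neg[OF G''(1)] by simp
  thus ?thesis using G''(1) ik(1) by (metis zero_less_diff)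
qed

text \<open>Adding the inverse \<open>c\<close> of \<open>a\<close> reduces the claim to a
  nonnegative element \<open>b + c\<close> whose \<open>n\<close>-fold multiple is \<open>0\<close>;
  it is squeezed between \<open>0\<close> and that multiple.\<close>

lemma torsion_unique:
  fixes a b :: "'m::{linorder, ordered_comm_monoid_add}"
  assumes inv: "a + c = 0" and n: "n > 0" "nat_mult n a = nat_mult n b" and le: "a \<le> b"
  shows "a = b"
proof -
  obtain k where k: "n = Suc k" using n(1) gr0_implies_Suc by blast
  have "a + c \<le> b + c" using le by (rule add_right_mono)
  hence pos: "0 \<le> b + c" using inv by simp
  have "nat_mult n (b + c) = nat_mult n (a + c)" using n(2) by (simp add: nat_mult_distrib)
  hence "b + c + nat_mult k (b + c) = 0" using inv by (simp add: k nat_mult_Suc)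
  moreover have "0 \<le> nat_mult k (b + c)" using nat_mult_mono[OF pos, of k] by simp
  hence "b + c + 0 \<le> b + c + nat_mult k (b + c)" by (rule add_left_mono)
  ultimately have "b + c = 0" using pos by simp
  hence "b + (a + c) = a" by (simp add: add.left_commute)
  thus ?thesis using inv by simp
qed

text \<open>An element \<open>m\<close> with \<open>nat_mult n m = \<phi> \<gamma>\<close> must go
  to the unique \<open>n\<close>-th part of \<open>j \<gamma>\<close> in the divisible group;
  independence of the choice of \<open>n\<close> and \<open>\<gamma>\<close> makes this a
  map.\<close>

lemma embedding_into_divisible_hull:
  fixes T :: "'m::{linorder, ordered_comm_monoid_add} set"
    and \<Gamma> :: "'g::linordered_ab_group_add set"
    and j :: "'g \<Rightarrow> 'd::linordered_ab_group_add"
  assumes T: "submonoid T" and \<Gamma>: "submonoid \<Gamma>" "\<And>\<gamma>. \<gamma> \<in> \<Gamma> \<Longrightarrow> - \<gamma> \<in> \<Gamma>"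
    and phi: "ordered_monoid_embedding \<Gamma> \<phi>" and hull: "divisible_hull \<Gamma> j"
    and torsion: "\<And>m. m \<in> T \<Longrightarrow> \<exists>n>0. \<exists>\<gamma>\<in>\<Gamma>. nat_mult n m = \<phi> \<gamma>"
  shows "\<exists>e. ordered_monoid_embedding T e \<and> (\<forall>\<gamma>\<in>\<Gamma>. e (\<phi> \<gamma>) = j \<gamma>)"
proof -
  have j: "ordered_monoid_embedding \<Gamma> j" and div: "\<And>n d. n > 0 \<Longrightarrow> \<exists>d'. nat_mult n d' = (d :: 'd)"
    using hull by (auto simp: divisible_hull_def)
  note phi_mult = embedding_nat_mult[OF phi \<Gamma>(1)] and j_mult = embedding_nat_mult[OF j \<Gamma>(1)]
  note phi_le = ordered_monoid_embedding_le_iff[OF phi] and j_le = ordered_monoid_embedding_le_iff[OF j]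
    and phi_eq = ordered_monoid_embedding_eq_iff[OF phi] and j_eq = ordered_monoid_embedding_eq_iff[OF j]
    and phi_add = ordered_monoid_embedding_add[OF phi] and j_add = ordered_monoid_embedding_add[OF j]
  have zero: "\<phi> 0 = 0" "j 0 = 0" using phi j by (auto simp: ordered_monoid_embedding_def)
  define rel where "rel m d \<longleftrightarrow> (\<exists>n>0. \<exists>\<gamma>\<in>\<Gamma>. nat_mult n m = \<phi> \<gamma> \<and> nat_mult n d = j \<gamma>)" for m d
  \<comment> \<open>A common multiplier for two elements moves equations and comparisons into
    \<open>\<Gamma>\<close>, where both \<open>\<phi>\<close> and \<open>j\<close> are
    embeddings.\<close>
  have common: "\<exists>n>0. \<exists>\<gamma>\<in>\<Gamma>. \<exists>\<gamma>'\<in>\<Gamma>. nat_mult n m = \<phi> \<gamma> \<and> nat_mult n d = j \<gamma> \<and>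
      nat_mult n m' = \<phi> \<gamma>' \<and> nat_mult n d' = j \<gamma>'" if md: "rel m d" "rel m' d'" for m d m' d'
  proof -
    obtain n \<gamma> where 1: "n > 0" "\<gamma> \<in> \<Gamma>" "nat_mult n m = \<phi> \<gamma>" "nat_mult n d = j \<gamma>"
      using md(1) by (auto simp: rel_def)
    obtain n' \<gamma>' where 2: "n' > 0" "\<gamma>' \<in> \<Gamma>" "nat_mult n' m' = \<phi> \<gamma>'" "nat_mult n' d' = j \<gamma>'"
      using md(2) by (auto simp: rel_def)
    have "nat_mult (n * n') m = \<phi> (nat_mult n' \<gamma>)" "nat_mult (n * n') d = j (nat_mult n' \<gamma>)"
        "nat_mult (n * n') m' = \<phi> (nat_mult n \<gamma>')" "nat_mult (n * n') d' = j (nat_mult n \<gamma>')"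
      using 1 2 phi_mult[of \<gamma> n'] phi_mult[of \<gamma>' n] j_mult[of \<gamma> n'] j_mult[of \<gamma>' n]
      by (simp_all add: nat_mult_mult nat_mult_swap[of n n'])
    moreover have "nat_mult n' \<gamma> \<in> \<Gamma>" "nat_mult n \<gamma>' \<in> \<Gamma>" "n * n' > 0"
      using 1 2 phi_mult by auto
    ultimately show ?thesis by blast
  qed
  have rel_ex: "\<exists>d. rel m d" if "m \<in> T" for m
    using torsion[OF that] div unfolding rel_def by metis
  have rel_unique: "d = d'" if "rel m d" "rel m d'" for m d d'
    using common[OF that] phi_eq nat_mult_inj by metis
  have rel_add: "rel (m + m') (d + d')" if md: "rel m d" "rel m' d'" for m m' d d'
  proof -
    obtain n \<gamma> \<gamma>' where *: "n > 0" "\<gamma> \<in> \<Gamma>" "\<gamma>' \<in> \<Gamma>" "nat_mult n m = \<phi> \<gamma>" "nat_mult n d = j \<gamma>"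
        "nat_mult n m' = \<phi> \<gamma>'" "nat_mult n d' = j \<gamma>'"
      using common[OF md] by blast
    have "\<gamma> + \<gamma>' \<in> \<Gamma>" using * \<Gamma>(1) by (simp add: submonoid_def)
    moreover have "nat_mult n (m + m') = \<phi> (\<gamma> + \<gamma>')" "nat_mult n (d + d') = j (\<gamma> + \<gamma>')"
      using * by (simp_all add: nat_mult_distrib phi_add j_add)
    ultimately show ?thesis using *(1) unfolding rel_def by blast
  qed
  \<comment> \<open>As a summand of the invertible element \<open>\<phi> \<gamma>\<close>,
    \<open>m\<close> is itself invertible in the ambient monoid.\<close>
  have inverse: "\<exists>c. m + c = 0" if m: "m \<in> T" for m
  proof -
    obtain n \<gamma> where n: "n > 0" "\<gamma> \<in> \<Gamma>" "nat_mult n m = \<phi> \<gamma>" using torsion[OF m] by blast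
    obtain k where k: "n = Suc k" using n(1) gr0_implies_Suc by blast
    have "m + (nat_mult k m + \<phi> (- \<gamma>)) = \<phi> \<gamma> + \<phi> (- \<gamma>)"
      using n(3) by (simp add: k nat_mult_Suc add.assoc[symmetric])
    also have "\<dots> = 0" using phi_add[OF n(2) \<Gamma>(2)[OF n(2)]] zero by simp
    finally show ?thesis by blast
  qed
  have rel_less: "d < d'" if md: "rel m d" "rel m' d'" "m < m'" "m \<in> T" for m m' d d'
  proof -
    obtain n \<gamma> \<gamma>' where *: "n > 0" "\<gamma> \<in> \<Gamma>" "\<gamma>' \<in> \<Gamma>" "nat_mult n m = \<phi> \<gamma>" "nat_mult n d = j \<gamma>"
        "nat_mult n m' = \<phi> \<gamma>'" "nat_mult n d' = j \<gamma>'"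
      using common[OF md(1,2)] by blast
    obtain c where c: "m + c = 0" using inverse[OF md(4)] by blast
    have "nat_mult n m \<le> nat_mult n m'" using md(3) by (intro nat_mult_mono) simp
    \<comment> \<open>Strictness survives multiplication by \<open>n\<close> because
      \<open>m\<close> is invertible.\<close>
    moreover have "nat_mult n m \<noteq> nat_mult n m'" using torsion_unique[OF c *(1) _ less_imp_le[OF md(3)]] md(3) by auto
    ultimately have "\<gamma> < \<gamma>'" using *(4,6) phi_le[OF *(2,3)] phi_eq[OF *(2,3)] by auto
    hence "j \<gamma> < j \<gamma>'" using j_le[OF *(2,3)] j_eq[OF *(2,3)] by (simp add: less_le)
    hence "nat_mult n d < nat_mult n d'" using *(5,7) by simp
    thus ?thesis using nat_mult_less_iff[OF *(1)] by blast
  qed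
  define e where "e m = (THE d. rel m d)" for m
  have e: "e m = d" if "rel m d" for m d
    unfolding e_def using that rel_unique by (intro the_equality) auto
  have rel_phi: "rel (\<phi> \<gamma>) (j \<gamma>)" if "\<gamma> \<in> \<Gamma>" for \<gamma>
    using that unfolding rel_def by (metis nat_mult_1 zero_less_Suc)
  have e_phi: "e (\<phi> \<gamma>) = j \<gamma>" if "\<gamma> \<in> \<Gamma>" for \<gamma> using e rel_phi[OF that] by blast
  have "ordered_monoid_embedding T e"
    unfolding ordered_monoid_embedding_def
  proof (intro conjI ballI)
    show "e 0 = 0" using e_phi[of 0] \<Gamma>(1) zero by (simp add: submonoid_def)
    show "e (a + b) = e a + e b" if "a \<in> T" "b \<in> T" for a b
      using rel_ex[OF that(1)] rel_ex[OF that(2)] e rel_add by metis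
    show "strict_mono_on T e"
      using rel_ex e rel_less by (intro strict_mono_onI) metis
  qed
  thus ?thesis using e_phi by blast
qed

text \<open>Lets torsion pass from the generators \<open>value_set w\<close> to the whole value
  monoid, which is the least submonoid containing them.\<close>

lemma submonoid_torsion:
  assumes \<Gamma>: "submonoid \<Gamma>" and phi: "ordered_monoid_embedding \<Gamma> \<phi>"
  shows "submonoid {m. \<exists>n>0. \<exists>\<gamma>\<in>\<Gamma>. nat_mult n m = \<phi> \<gamma>}"
  unfolding submonoid_def
proof (intro conjI ballI)
  have "nat_mult (Suc 0) 0 = \<phi> 0" "0 \<in> \<Gamma>"
    using phi \<Gamma> by (auto simp: ordered_monoid_embedding_def submonoid_def)
  thus "0 \<in> {m. \<exists>n>0. \<exists>\<gamma>\<in>\<Gamma>. nat_mult n m = \<phi> \<gamma>}" by blast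
  fix a b
  assume "a \<in> {m. \<exists>n>0. \<exists>\<gamma>\<in>\<Gamma>. nat_mult n m = \<phi> \<gamma>}" "b \<in> {m. \<exists>n>0. \<exists>\<gamma>\<in>\<Gamma>. nat_mult n m = \<phi> \<gamma>}"
  then obtain n \<gamma> n' \<gamma>' where *: "n > 0" "\<gamma> \<in> \<Gamma>" "nat_mult n a = \<phi> \<gamma>"
      "n' > 0" "\<gamma>' \<in> \<Gamma>" "nat_mult n' b = \<phi> \<gamma>'" by blast
  have "nat_mult (n * n') a = nat_mult n' (\<phi> \<gamma>)" "nat_mult (n * n') b = nat_mult n (\<phi> \<gamma>')"
    using *(3,6) nat_mult_mult[of n n' b] nat_mult_mult[of n' n a] by (simp_all add: mult.commute)
  hence "nat_mult (n * n') (a + b) = \<phi> (nat_mult n' \<gamma> + nat_mult n \<gamma>')"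
    using * embedding_nat_mult[OF phi \<Gamma>, of \<gamma> n'] embedding_nat_mult[OF phi \<Gamma>, of \<gamma>' n] phi
    by (simp add: nat_mult_distrib ordered_monoid_embedding_def)
  moreover have "nat_mult n' \<gamma> + nat_mult n \<gamma>' \<in> \<Gamma>"
    using * embedding_nat_mult[OF phi \<Gamma>] \<Gamma> by (simp add: submonoid_def)
  ultimately show "a + b \<in> {m. \<exists>n>0. \<exists>\<gamma>\<in>\<Gamma>. nat_mult n m = \<phi> \<gamma>}"
    using *(1,4) by (metis (mono_tags, lifting) mem_Collect_eq nat_0_less_mult_iff)
qed

section \<open>Transfer of the quasi-valuation to the divisible hull\<close>

theorem theorem7p7:
  fixes \<iota> :: "'f::field \<Rightarrow> 'e::field"
    and v :: "'f \<Rightarrow> 'g::linordered_ab_group_add with_infinity"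
    and w :: "'e \<Rightarrow> 'm::{linorder, ordered_comm_monoid_add} with_infinity"
    and \<phi> :: "'g \<Rightarrow> 'm"
    and j :: "'g \<Rightarrow> 'd::linordered_ab_group_add"
  assumes "finite_field_extension \<iota>"
    and "valuation v"
    and "quasi_valuation w"
    and "extends_valuation \<iota> \<phi> v w"
    and "exponential w"
    and "weakly_cancellative (value_monoid w)"
    and "divisible_hull (value_set v) j"
  shows "\<exists>e. embedding_over \<phi> j v w e \<and>
           (\<exists>U :: ('e \<Rightarrow> 'd with_infinity) set.
              finite U \<and> U \<noteq> {} \<and>
              (\<forall>u\<in>U. valuation u \<and> extends_valuation \<iota> j v u) \<and>
              (\<forall>x. map_with_infinity e (w x) = Min ((\<lambda>u. u x) ` U)))"
proof -
  note w = assms(3,5)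
  let ?M = "value_monoid w" and ?\<Gamma> = "value_set v"
  have phi: "ordered_monoid_embedding ?\<Gamma> \<phi>" and w_emb: "\<And>a. w (\<iota> a) = map_with_infinity \<phi> (v a)"
    using assms(4) by (auto simp: extends_valuation_def)
  have j: "ordered_monoid_embedding ?\<Gamma> j" using assms(7) by (simp add: divisible_hull_def)
  have "value_set w \<subseteq> {m. \<exists>n>0. \<exists>\<gamma>\<in>?\<Gamma>. nat_mult n m = \<phi> \<gamma>}"
    using value_set_torsion[OF assms(1,2) w assms(4,6)] by blast
  hence "?M \<subseteq> {m. \<exists>n>0. \<exists>\<gamma>\<in>?\<Gamma>. nat_mult n m = \<phi> \<gamma>}"
    unfolding value_monoid_def
    by (rule hull_minimal) (rule submonoid_torsion[OF submonoid_value_set[OF assms(2)] phi])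
  then obtain e where e: "ordered_monoid_embedding ?M e" "\<And>\<gamma>. \<gamma> \<in> ?\<Gamma> \<Longrightarrow> e (\<phi> \<gamma>) = j \<gamma>"
    using embedding_into_divisible_hull[OF submonoid_value_monoid submonoid_value_set[OF assms(2)]
        uminus_value_set[OF assms(2)] phi assms(7), of w] by blast
  note e_add = ordered_monoid_embedding_add[OF e(1)] and e_le = ordered_monoid_embedding_le_iff[OF e(1)]
  \<comment> \<open>The map \<open>e\<close> respects addition and order only on the value monoid,
    so the finite values of \<open>w\<close> and their sums have to be located there.\<close>
  have M_add: "a + b \<in> ?M" if "a \<in> ?M" "b \<in> ?M" for a b
    using that submonoid_value_monoid[of w] by (simp add: submonoid_def)
  define w' where "w' x = map_with_infinity e (w x)" for x
  have w_cases: "w x = Infinity \<or> (\<exists>m\<in>?M. w x = Fin m)" for x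
  proof (cases "x = 0")
    case True
    thus ?thesis using w(1) by (simp add: quasi_valuation_def)
  next
    case False
    then obtain m where "w x = Fin m" using quasi_valuation_not_Infinity[OF w] by (cases "w x") auto
    moreover from this have "m \<in> ?M"
      using False unfolding value_monoid_def by (intro hull_inc) (auto simp: value_set_def)
    ultimately show ?thesis by blast
  qed
  have w'_le: "w' x \<le> w' y \<longleftrightarrow> w x \<le> w y" for x y
    using w_cases[of x] w_cases[of y] by (auto simp: w'_def e_le)
  have qval: "quasi_valuation w'"
    unfolding quasi_valuation_def
  proof (intro conjI allI)
    show "w' 0 = Infinity" using w(1) by (simp add: w'_def quasi_valuation_def)
    fix x y
    have le: "w x + w y \<le> w (x * y)" and "min (w x) (w y) \<le> w (x + y)"
      using w(1) by (simp_all add: quasi_valuation_def)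
    thus "min (w' x) (w' y) \<le> w' (x + y)"
      using w'_le[of x y] w'_le[of x "x + y"] w'_le[of y "x + y"] by (auto simp: min_def split: if_splits)
    show "w' x + w' y \<le> w' (x * y)"
      using w_cases[of x] w_cases[of y] w_cases[of "x * y"] le
      by (auto simp: w'_def e_add[symmetric] e_le M_add)
  qed
  have expo: "exponential w'"
    unfolding exponential_def
  proof (intro allI)
    fix x n
    have "w (x ^ n) = nat_mult n (w x)" using w(2) by (simp add: exponential_def)
    \<comment> \<open>The case \<open>n = 0\<close> is separate because the empty multiple of
      \<open>Infinity\<close> is \<open>0\<close>.\<close>
    thus "w' (x ^ n) = nat_mult n (w' x)"
      using w_cases[of x] embedding_nat_mult[OF e(1) submonoid_value_monoid, of _ n]
        e(1) by (cases "n = 0") (auto simp: w'_def zero_with_infinity_def ordered_monoid_embedding_def)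
  qed
  define v' where "v' a = map_with_infinity j (v a)" for a
  have w'_emb: "w' (\<iota> a) = v' a" for a
    using valuation_eq_Infinity[OF assms(2), of a] e(2)
    by (cases "v a") (auto simp: w'_def v'_def w_emb value_set_def)
  interpret valued_extension \<iota> v'
  proof
    show "finite_field_extension \<iota>" by (rule assms(1))
    show "valuation v'" unfolding v'_def by (rule valuation_map[OF assms(2) j])
    show "\<exists>d'. nat_mult n d' = d" if "n > 0" for n and d :: 'd
      using assms(7) that by (simp add: divisible_hull_def)
    show "\<exists>n>0. \<exists>a. v' a = Fin (nat_mult n d)" for d
    proof -
      obtain n \<gamma> where n: "n > 0" "\<gamma> \<in> ?\<Gamma>" "nat_mult n d = j \<gamma>"
        using assms(7) unfolding divisible_hull_def by blast
      then obtain a where "v a = Fin \<gamma>" by (auto simp: value_set_def)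
      hence "v' a = Fin (nat_mult n d)" using n by (simp add: v'_def)
      thus ?thesis using n by blast
    qed
  qed
  obtain U where U: "U \<subseteq> extensions" "finite U" "U \<noteq> {}" "\<And>x. w' x = Min ((\<lambda>u. u x) ` U)"
    using exponential_eq_Min[OF qval expo w'_emb] by blast
  have "valuation u \<and> extends_valuation \<iota> j v u" if "u \<in> U" for u
    using that U(1) j by (auto simp: extensions_def extends_valuation_def v'_def)
  thus ?thesis
    using e U unfolding embedding_over_def w'_def by (intro exI[of _ e] conjI exI[of _ U]) auto
qed

end
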